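(* Let $M\in\mathbb{R}^{n\times n}$ be a symmetric positive definite matrix with eigenvalues $\lambda_1\ge\lambda_2\ge\cdots\ge\lambda_n>0$, let $1\le p\le n-1$, and let $\widehat{M}$ be a maximal volume pseudo skeleton approximation of $M$ with parameters $p=q$ (so that it is built from a $p\times p$ principal submatrix $A$ of maximal volume). Then $r:=\operatorname{rank}(\widehat{M})$ satisfies $r=p$, and $$\left\|M-\widehat{M}\right\|_C\le \zeta_r(M)\,\lambda_{r+1}.$$
   Context: Chebyshev norm: $\|X\|_C=\max_{i,j}|X_{i,j}|$. Pseudo skeleton approximation: let $M\in\mathbb{R}^{m\times n}$ and let $P_1\in\mathbb{R}^{m\times m}$, $P_2\in\mathbb{R}^{n\times n}$ be permutation matrices with $P_1MP_2^T=\begin{bmatrix}A&B\\C&D\end{bmatrix}$, $A\in\mathbb{R}^{p\times q}$. With $A^+$ the Moore-Penrose inverse of $A$, the matrix $\widehat{M}=P_1^T\begin{bmatrix}A\\C\end{bmatrix}A^+\begin{bmatrix}A&B\end{bmatrix}P_2$ is called a pseudo skeleton approximation of $M$ with parameters $p,q$. It is called a maximal volume approximation if $P_1,P_2$ are chosen (among all pairs of permutations) so that $\operatorname{rank}(A)=r$ is maximal and, subject to this, the $r$-volume $\operatorname{vol}_r(A)=\sigma_1(A)\cdots\sigma_r(A)$ is maximal, where $\sigma_1(A)\ge\sigma_2(A)\ge\cdots$ are the singular values of $A$. For symmetric positive definite $M\in\mathbb{R}^{n\times n}$ and $p=q$, the standing convention is that $A$ is a principal submatrix of $M$ with maximal volume,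 i.e. $P_1=P_2$. For a symmetric matrix $M$ whose eigenvalues in decreasing order are $\lambda_1\ge\lambda_2\ge\cdots$ with $\lambda_{r+1}>0$, define $\zeta_r(M)=H(\lambda_1,\ldots,\lambda_{r+1})/\lambda_{r+1}$, where $H(\lambda_1,\ldots,\lambda_{r+1})=\dfrac{r+1}{\lambda_1^{-1}+\cdots+\lambda_{r+1}^{-1}}$ is the harmonic mean. *)

theory Defs
  imports
    "Jordan_Normal_Form.Char_Poly"
    "Jordan_Normal_Form.DL_Rank"
begin

definition cheb_norm :: "real mat \<Rightarrow> real" where
  "cheb_norm X = Max (abs ` elements_mat X)"

definition positive_definite :: "nat \<Rightarrow> real mat \<Rightarrow> bool" where
  "positive_definite n M \<longleftrightarrow>
     M \<in> carrier_mat n n \<and> M\<^sup>T = M \<and>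
     (\<forall>v \<in> carrier_vec n. v \<noteq> 0\<^sub>v n \<longrightarrow> 0 < v \<bullet> (M *\<^sub>v v))"

abbreviation mat_rank :: "real mat \<Rightarrow> nat" where
  "mat_rank A \<equiv> vec_space.rank (dim_row A) A"

text \<open>The real eigenvalues of a square matrix, in decreasing order and repeated according to
  algebraic multiplicity. For a symmetric matrix this is the full list of its eigenvalues.
  The index of \<open>eigval\<close> and \<open>sing_val\<close> starts at 1.\<close>

definition eigvals_desc :: "real mat \<Rightarrow> real list" where
  "eigvals_desc A = rev (sorted_list_of_multiset (proots (char_poly A)))"

definition eigval :: "real mat \<Rightarrow> nat \<Rightarrow> real" where
  "eigval A k = eigvals_desc A ! (k - 1)"

text \<open>\<open>sing_val A k\<close> is meaningful for \<open>1 \<le> k \<le> dim_col A\<close>; past \<open>dim_row A\<close> the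
  values are padded with 0, which is immaterial for the volume with \<open>r \<le> rank A\<close>.\<close>

definition sing_val :: "real mat \<Rightarrow> nat \<Rightarrow> real" where
  "sing_val A k = sqrt (eigval (A\<^sup>T * A) k)"

definition vol :: "nat \<Rightarrow> real mat \<Rightarrow> real" where
  "vol r A = (\<Prod>i = 1..r. sing_val A i)"

definition is_moore_penrose :: "real mat \<Rightarrow> real mat \<Rightarrow> bool" where
  "is_moore_penrose A X \<longleftrightarrow>
     X \<in> carrier_mat (dim_col A) (dim_row A) \<and>
     A * X * A = A \<and> X * A * X = X \<and> (A * X)\<^sup>T = A * X \<and> (X * A)\<^sup>T = X * A"

definition pinv :: "real mat \<Rightarrow> real mat" where
  "pinv A = (THE X. is_moore_penrose A X)"

definition is_permutation_mat :: "nat \<Rightarrow> real mat \<Rightarrow> bool" where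
  "is_permutation_mat n P \<longleftrightarrow>
     (\<exists>\<pi>. \<pi> permutes {0..<n} \<and> P = mat n n (\<lambda>(i, j). if j = \<pi> i then 1 else 0))"

definition permuted_blocks ::
  "real mat \<Rightarrow> nat \<Rightarrow> nat \<Rightarrow> real mat \<Rightarrow> real mat \<Rightarrow> real mat \<times> real mat \<times> real mat \<times> real mat" where
  "permuted_blocks M p q P1 P2 = split_block (P1 * M * P2\<^sup>T) p q"

definition leading_block ::
  "real mat \<Rightarrow> nat \<Rightarrow> nat \<Rightarrow> real mat \<Rightarrow> real mat \<Rightarrow> real mat" where
  "leading_block M p q P1 P2 = (case permuted_blocks M p q P1 P2 of (A, B, C, D) \<Rightarrow> A)"

text \<open>The block row \<open>[A B]\<close> is expressed as the transpose of \<open>A\<^sup>T\<close> stacked on \<open>B\<^sup>T\<close>.\<close>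

definition pseudo_skeleton ::
  "real mat \<Rightarrow> nat \<Rightarrow> nat \<Rightarrow> real mat \<Rightarrow> real mat \<Rightarrow> real mat" where
  "pseudo_skeleton M p q P1 P2 =
     (case permuted_blocks M p q P1 P2 of (A, B, C, D) \<Rightarrow>
        P1\<^sup>T * (A @\<^sub>r C) * pinv A * (A\<^sup>T @\<^sub>r B\<^sup>T)\<^sup>T * P2)"

definition permutation_pairs :: "nat \<Rightarrow> nat \<Rightarrow> (real mat \<times> real mat) set" where
  "permutation_pairs m n = {(P1, P2). is_permutation_mat m P1 \<and> is_permutation_mat n P2}"

definition principal_pairs :: "nat \<Rightarrow> (real mat \<times> real mat) set" where
  "principal_pairs n = {(P, P) | P. is_permutation_mat n P}"

text \<open>\<open>S\<close> is the set of pairs of permutation matrices over which the rank of the leading block,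
  and then its volume, is maximized: \<open>permutation_pairs m n\<close> for a general matrix, and
  \<open>principal_pairs n\<close> for a symmetric positive definite matrix with \<open>p = q\<close>.\<close>

definition max_volume_choice ::
  "(real mat \<times> real mat) set \<Rightarrow> real mat \<Rightarrow> nat \<Rightarrow> nat \<Rightarrow> real mat \<Rightarrow> real mat \<Rightarrow> bool" where
  "max_volume_choice S M p q P1 P2 \<longleftrightarrow>
     (P1, P2) \<in> S \<and>
     (\<forall>(Q1, Q2) \<in> S.
        let A = leading_block M p q P1 P2; A' = leading_block M p q Q1 Q2; r = mat_rank A in
        mat_rank A' < r \<or> mat_rank A' = r \<and> vol r A' \<le> vol r A)"

text \<open>A principal choice that is maximal among all pairs is in particular maximal among the
  principal ones, so being a maximal choice over \<open>principal_pairs n\<close> is the weaker requirement.\<close>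

lemma max_volume_choice_principal:
  assumes "max_volume_choice (permutation_pairs n n) M p p P P"
  shows "max_volume_choice (principal_pairs n) M p p P P"
  using assms
  by (fastforce simp: max_volume_choice_def permutation_pairs_def principal_pairs_def Let_def)

definition max_volume_pseudo_skeleton ::
  "(real mat \<times> real mat) set \<Rightarrow> real mat \<Rightarrow> nat \<Rightarrow> nat \<Rightarrow> real mat \<Rightarrow> bool" where
  "max_volume_pseudo_skeleton S M p q N \<longleftrightarrow>
     (\<exists>P1 P2. max_volume_choice S M p q P1 P2 \<and> N = pseudo_skeleton M p q P1 P2)"

definition harmonic_mean :: "nat \<Rightarrow> (nat \<Rightarrow> real) \<Rightarrow> real" where
  "harmonic_mean k x = real k / (\<Sum>i = 1..k. inverse (x i))"

definition zeta :: "nat \<Rightarrow> real mat \<Rightarrow> real" where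
  "zeta r M = harmonic_mean (r + 1) (eigval M) / eigval M (r + 1)"

end

theory Submission
  imports Defs "Jordan_Normal_Form.Schur_Decomposition"
begin

text \<open>Let \<open>N\<close> be \<open>M\<close> after the simultaneous permutation and \<open>E\<close> the first \<open>p\<close> columns of the identity.
  The residual \<open>S = N - N E A\<^sup>-\<^sup>1 E\<^sup>T N\<close> is the Schur complement of the leading block \<open>A\<close>, padded
  with zeros. It is positive semidefinite, so its largest entry is on the diagonal.
  The diagonal entry at \<open>k\<close> equals \<open>det K / det A\<close>, where \<open>K\<close> borders \<open>A\<close> with row and column
  \<open>k\<close> of \<open>N\<close>. The diagonal entries of \<open>K\<^sup>-\<^sup>1\<close> are the principal minors of \<open>K\<close> of order \<open>p\<close> divided
  by \<open>det K\<close>, and by maximality of the volume none of them exceeds \<open>det A / det K\<close>. Summing them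
  bounds the entry of \<open>S\<close> by the harmonic mean of the eigenvalues of \<open>K\<close>, which by interlacing is
  at most that of the top \<open>p + 1\<close> eigenvalues of \<open>N\<close>.\<close>

section \<open>Spectral theorem for real symmetric matrices\<close>

abbreviation cmat :: "real mat \<Rightarrow> complex mat" where
  "cmat \<equiv> of_real_hom.mat_hom"

text \<open>The entries are real, so the conjugate of an eigenvector \<open>v\<close> is an
  eigenvector for \<open>cnj a\<close>. Moving the symmetric matrix from one factor of
  \<open>v \<bullet>c v\<close> to the other gives \<open>cnj a = a\<close>.\<close>

lemma symmetric_eigenvalue_real:
  assumes A: "A \<in> carrier_mat n n" and sym: "A\<^sup>T = A"
    and ev: "eigenvalue (cmat A) a"
  shows "a \<in> \<real>"
proof -
  let ?C = "cmat A"
  have C: "?C \<in> carrier_mat n n" using A by simp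
  have symC: "?C\<^sup>T = ?C" by (rule eq_matI) (use A sym in \<open>auto simp: mat_eq_iff[of "A\<^sup>T"]\<close>)
  from ev obtain v where v: "v \<in> carrier_vec n" and v0: "v \<noteq> 0\<^sub>v n" and Cv: "?C *\<^sub>v v = a \<cdot>\<^sub>v v"
    unfolding eigenvalue_def eigenvector_def using C by auto
  have Ccv: "?C *\<^sub>v conjugate v = cnj a \<cdot>\<^sub>v conjugate v"
  proof (rule eq_vecI)
    fix i assume "i < dim_vec (cnj a \<cdot>\<^sub>v conjugate v)"
    hence i: "i < n" using v by simp
    have "(?C *\<^sub>v conjugate v) $ i = cnj ((?C *\<^sub>v v) $ i)"
      using i A v by (simp add: scalar_prod_def)
    also have "\<dots> = (cnj a \<cdot>\<^sub>v conjugate v) $ i" using i v by (simp add: Cv)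
    finally show "(?C *\<^sub>v conjugate v) $ i = (cnj a \<cdot>\<^sub>v conjugate v) $ i" .
  qed (use A v in auto)
  have "cnj a * (v \<bullet>c v) = (?C *\<^sub>v conjugate v) \<bullet> v"
    using v by (simp add: Ccv comm_scalar_prod[of "conjugate v" n v])
  also have "\<dots> = conjugate v \<bullet> (?C *\<^sub>v v)"
    using transpose_vec_mult_scalar[OF C v, of "conjugate v"] v symC by simp
  also have "\<dots> = a * (v \<bullet>c v)"
    using v by (simp add: Cv comm_scalar_prod[of "conjugate v" n v])
  finally have "cnj a = a" using conjugate_square_eq_0_vec[OF v] v0 by simp
  thus ?thesis by (simp add: Reals_cnj_iff)
qed

text \<open>Linear factors exist over the complex numbers. Their roots are real, so the
  factorization is the image of a real one, and the embedding of polynomials is injective.\<close>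

lemma symmetric_char_poly_splits:
  fixes A :: "real mat"
  assumes A: "A \<in> carrier_mat n n" and sym: "A\<^sup>T = A"
  shows "\<exists>es. char_poly A = (\<Prod>e\<leftarrow>es. [:- e, 1:]) \<and> length es = n"
proof -
  interpret map_poly_inj_idom_hom "of_real :: real \<Rightarrow> complex" ..
  have C: "cmat A \<in> carrier_mat n n" using A by simp
  from char_poly_factorized[OF C] obtain as
    where as: "char_poly (cmat A) = (\<Prod>a\<leftarrow>as. [:- a, 1:])" and len: "length as = n" by auto
  have real: "of_real (Re a) = a" if "a \<in> set as" for a
  proof -
    have "poly (char_poly (cmat A)) a = 0" unfolding as using that by (rule linear_poly_root)
    hence "eigenvalue (cmat A) a" using eigenvalue_root_char_poly[OF C] by simp
    from symmetric_eigenvalue_real[OF A sym this] show ?thesis by (simp add: of_real_Re)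
  qed
  have "map_poly of_real (\<Prod>e\<leftarrow>map Re as. [:- e, 1:]) = (\<Prod>a\<leftarrow>as. [:- a, 1:])"
    using real by (induction as) (auto simp del: mult_pCons_left simp: hom_mult)
  also have "\<dots> = map_poly of_real (char_poly A)"
    unfolding as[symmetric] by (rule of_real_hom.char_poly_hom[OF A])
  finally have "char_poly A = (\<Prod>e\<leftarrow>map Re as. [:- e, 1:])" by (metis injectivity)
  with len show ?thesis by (metis length_map)
qed

text \<open>Supplies the basis for the deflation below. Gram-Schmidt on a basis completion of
  \<open>v\<close> leaves \<open>v\<close> in first place; its output is orthogonal but not
  normalized, whence the factors \<open>c\<close>.\<close>

lemma ex_orthogonal_mat_first_col:
  fixes v :: "real vec"
  assumes v: "v \<in> carrier_vec n" and v0: "v \<noteq> 0\<^sub>v n"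
  obtains W c where "W \<in> carrier_mat n n" "W\<^sup>T * W = 1\<^sub>m n" "col W 0 = c \<cdot>\<^sub>v v"
proof -
  interpret cof_vec_space n "TYPE(real)" .
  define ws where "ws = gram_schmidt n (basis_completion v)"
  note bc = basis_completion[OF v v0]
  note gs = gram_schmidt_result[OF bc(2) bc(4) bc(5) ws_def]
  have n0: "n > 0" using v v0 by (cases n) auto
  have ws0: "ws ! 0 = v"
  proof -
    from bc(6,7) n0 obtain us where "basis_completion v = v # us"
      by (cases "basis_completion v") auto
    hence "hd ws = v" unfolding ws_def using v by simp
    thus ?thesis using gs(4) bc(6) n0 by (cases ws) auto
  qed
  define c where "c w = inverse (sqrt (w \<bullet> w))" for w :: "real vec"
  define us where "us = map (\<lambda>w. c w \<cdot>\<^sub>v w) ws"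
  define W where "W = mat_of_cols n us"
  have len: "length ws = n" "length us = n" using gs(4) bc(6) by (auto simp: us_def)
  have wsc: "ws ! i \<in> carrier_vec n" if "i < n" for i using gs(3) len that by auto
  have W: "W \<in> carrier_mat n n" unfolding W_def using len by (metis mat_of_cols_carrier(1))
  have colW: "col W i = c (ws ! i) \<cdot>\<^sub>v ws ! i" if "i < n" for i
    unfolding W_def using that len wsc by (simp add: us_def)
  have "W\<^sup>T * W = 1\<^sub>m n"
  proof (rule eq_matI)
    fix i j assume "i < dim_row (1\<^sub>m n)" "j < dim_col (1\<^sub>m n)"
    hence ij: "i < n" "j < n" by auto
    have orth: "(ws ! i \<bullet> ws ! j = 0) = (i \<noteq> j)"
      using corthogonalD[OF gs(2), of i j] len ij by simp
    have pos: "0 \<le> ws ! i \<bullet> ws ! i" by (simp add: scalar_prod_def sum_nonneg)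
    have "(W\<^sup>T * W) $$ (i, j) = c (ws ! i) * (c (ws ! j) * (ws ! i \<bullet> ws ! j))"
      using ij W wsc[OF ij(1)] wsc[OF ij(2)] by (simp add: colW)
    also have "\<dots> = 1\<^sub>m n $$ (i, j)"
    proof (cases "i = j")
      case True
      with orth have "ws ! i \<bullet> ws ! i \<noteq> 0" by simp
      with pos True ij show ?thesis
        by (simp add: c_def field_simps)
    qed (use orth ij in simp)
    finally show "(W\<^sup>T * W) $$ (i, j) = 1\<^sub>m n $$ (i, j)" .
  qed (use W in auto)
  moreover have "col W 0 = c v \<cdot>\<^sub>v v" using colW[OF n0] ws0 by simp
  ultimately show ?thesis using W that by blast
qed

text \<open>Deflation: in an orthonormal basis that starts with an eigenvector for \<open>e\<close>,
  the matrix is block diagonal with \<open>e\<close> in the corner, and the induction hypothesis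
  treats the other block. The order of \<open>es\<close> is free, so the sorted eigenvalue list can
  be inserted later.\<close>

theorem symmetric_diagonalization:
  fixes A :: "real mat"
  assumes "A \<in> carrier_mat n n" and "A\<^sup>T = A"
    and "char_poly A = (\<Prod>e\<leftarrow>es. [:- e, 1:])"
  shows "\<exists>W \<in> carrier_mat n n. W\<^sup>T * W = 1\<^sub>m n \<and> W\<^sup>T * A * W = mat_diag n ((!) es)"
  using assms
proof (induction es arbitrary: n A)
  case Nil
  from degree_monic_char_poly[OF Nil(1)] Nil(3) have "n = 0" by simp
  thus ?case by (intro bexI[of _ "1\<^sub>m n"]) (auto simp: mat_diag_def)
next
  case (Cons e es n A)
  note A = Cons.prems(1) and sym = Cons.prems(2) and cp = Cons.prems(3)
  have "poly (char_poly A) e = 0" unfolding cp by simp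
  hence "eigenvalue A e" using eigenvalue_root_char_poly[OF A] by simp
  then obtain v where v: "v \<in> carrier_vec n" and v0: "v \<noteq> 0\<^sub>v n" and Av: "A *\<^sub>v v = e \<cdot>\<^sub>v v"
    unfolding eigenvalue_def eigenvector_def using A by auto
  from ex_orthogonal_mat_first_col[OF v v0] obtain V c where V: "V \<in> carrier_mat n n"
    and VV: "V\<^sup>T * V = 1\<^sub>m n" and V0: "col V 0 = c \<cdot>\<^sub>v v" .
  obtain m where n: "n = Suc m" using v v0 by (cases n) auto
  have VV': "V * V\<^sup>T = 1\<^sub>m n" using mat_mult_left_right_inverse[OF _ V VV] V by simp
  have AV0: "A *\<^sub>v col V 0 = e \<cdot>\<^sub>v col V 0"
    unfolding V0 using A v by (simp add: mult_mat_vec Av smult_smult_assoc mult.commute)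
  define B where "B = V\<^sup>T * A * V"
  have B: "B \<in> carrier_mat n n" unfolding B_def using A V by simp
  have symB: "B\<^sup>T = B" unfolding B_def using A V sym
    by (simp add: transpose_mult[of _ n n _ n] assoc_mult_mat[of _ n n _ n _ n])
  \<comment> \<open>\<open>V\<close> maps the first unit vector to an eigenvector, so the first
    column of \<open>B\<close> is \<open>e\<close> times the first unit vector; symmetry settles the
    first row.\<close>
  have B0: "B $$ (i, 0) = (if i = 0 then e else 0)" if i: "i < n" for i
  proof -
    have "B $$ (i, 0) = col V i \<bullet> (A *\<^sub>v col V 0)"
      unfolding B_def using A V i n
      by (simp add: assoc_mult_mat[of _ n n _ n _ n] mult_mat_vec_def)
    also have "\<dots> = e * (V\<^sup>T * V) $$ (i, 0)"
      unfolding AV0 using V i n by simp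
    also have "\<dots> = (if i = 0 then e else 0)" unfolding VV using i n by simp
    finally show ?thesis .
  qed
  have B0': "B $$ (0, i) = (if i = 0 then e else 0)" if "i < n" for i
    using B0[OF that] symB B that n by (metis carrier_matD index_transpose_mat(1) zero_less_Suc)
  define B1 where "B1 = mat m m (\<lambda>(i, j). B $$ (Suc i, Suc j))"
  have B1: "B1 \<in> carrier_mat m m" by (simp add: B1_def)
  let ?e = "mat 1 1 (\<lambda>_. e)"
  have Bblock: "B = four_block_mat ?e (0\<^sub>m 1 m) (0\<^sub>m m 1) B1"
    by (rule eq_matI) (use B n in \<open>auto simp: B1_def B0 B0' four_block_mat_def Let_def\<close>)
  have symB1: "B1\<^sup>T = B1"
  proof (rule eq_matI)
    fix i j assume "i < dim_row B1" "j < dim_col B1"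
    hence "i < m" "j < m" using B1 by auto
    thus "B1\<^sup>T $$ (i, j) = B1 $$ (i, j)" unfolding B1_def
      using symB B n by simp (metis carrier_matD index_transpose_mat(1) Suc_less_eq)
  qed (use B1 in auto)
  \<comment> \<open>Similarity and the block form let the factor \<open>[:- e, 1:]\<close> cancel,
    which yields the factorization that the induction hypothesis requires of
    \<open>B1\<close>.\<close>
  have sim: "similar_mat B A"
    unfolding similar_mat_def similar_mat_wit_def Let_def B_def
    by (rule exI[of _ "V\<^sup>T"], rule exI[of _ V]) (use A V VV VV' in auto)
  have "char_poly ?e = [:- e, 1:]"
    by (subst char_poly_upper_triangular[of _ 1]) (auto simp: diag_mat_def)
  hence "[:- e, 1:] * char_poly B1 = char_poly B"
    unfolding Bblock by (subst char_poly_four_block_zeros_col[OF _ _ B1]) auto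
  also have "\<dots> = [:- e, 1:] * (\<Prod>e\<leftarrow>es. [:- e, 1:])"
    unfolding char_poly_similar[OF sim] cp by simp
  finally have "char_poly B1 = (\<Prod>e\<leftarrow>es. [:- e, 1:])" by (simp del: mult_pCons_left)
  from Cons.IH[OF B1 symB1 this] obtain U where U: "U \<in> carrier_mat m m"
    and UU: "U\<^sup>T * U = 1\<^sub>m m" and UBU: "U\<^sup>T * B1 * U = mat_diag m ((!) es)" by auto
  \<comment> \<open>\<open>Q\<close> fixes the coordinate already split off and acts by
    \<open>U\<close> on the rest, so \<open>V * Q\<close> diagonalizes \<open>A\<close>.\<close>
  define Q where "Q = four_block_mat (1\<^sub>m 1) (0\<^sub>m 1 m) (0\<^sub>m m 1) U"
  have Q: "Q \<in> carrier_mat n n" unfolding Q_def n using U by auto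
  have QT: "Q\<^sup>T = four_block_mat (1\<^sub>m 1) (0\<^sub>m 1 m) (0\<^sub>m m 1) (U\<^sup>T)"
    unfolding Q_def using U by (subst transpose_four_block_mat) auto
  have one_n: "1\<^sub>m n = four_block_mat (1\<^sub>m 1) (0\<^sub>m 1 m) (0\<^sub>m m 1) (1\<^sub>m m :: real mat)"
    unfolding n by simp
  have QQ: "Q\<^sup>T * Q = 1\<^sub>m n"
    unfolding QT unfolding Q_def one_n using U
    by (subst mult_four_block_mat[of _ 1 1 _ m _ m _ _ 1 _ m]) (auto simp: UU)
  have QBQ: "Q\<^sup>T * B * Q = mat_diag n ((!) (e # es))"
  proof -
    have "Q\<^sup>T * B = four_block_mat ?e (0\<^sub>m 1 m) (0\<^sub>m m 1) (U\<^sup>T * B1)"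
      unfolding QT Bblock using U B1
      by (subst mult_four_block_mat[of _ 1 1 _ m _ m _ _ 1 _ m]) auto
    hence "Q\<^sup>T * B * Q = four_block_mat ?e (0\<^sub>m 1 m) (0\<^sub>m m 1) (mat_diag m ((!) es))"
      unfolding Q_def using U B1
      by (simp, subst mult_four_block_mat[of _ 1 1 _ m _ m _ _ 1 _ m]) (auto simp: UBU)
    also have "\<dots> = mat_diag n ((!) (e # es))"
      by (rule eq_matI) (auto simp: n mat_diag_def four_block_mat_def Let_def nth_Cons')
    finally show ?thesis .
  qed
  show ?case
  proof (intro bexI[of _ "V * Q"] conjI)
    have "(V * Q)\<^sup>T * (V * Q) = Q\<^sup>T * (V\<^sup>T * V) * Q"
      using V Q by (simp add: transpose_mult[of _ n n _ n] assoc_mult_mat[of _ n n _ n _ n])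
    thus "(V * Q)\<^sup>T * (V * Q) = 1\<^sub>m n" using Q QQ VV by simp
    have "(V * Q)\<^sup>T * A * (V * Q) = Q\<^sup>T * B * Q" unfolding B_def
      using V Q A by (simp add: transpose_mult[of _ n n _ n] assoc_mult_mat[of _ n n _ n _ n])
    thus "(V * Q)\<^sup>T * A * (V * Q) = mat_diag n ((!) (e # es))" using QBQ by simp
  qed (use V Q in auto)
qed

text \<open>\<open>eigvals_desc\<close> collects only real roots, but here the characteristic
  polynomial splits over the reals, so no eigenvalue is lost.\<close>

lemma eigvals_desc_symmetric:
  assumes "A \<in> carrier_mat n n" and "A\<^sup>T = A"
  shows char_poly_eigvals_desc: "char_poly A = (\<Prod>e\<leftarrow>eigvals_desc A. [:- e, 1:])"
    and length_eigvals_desc: "length (eigvals_desc A) = n"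
proof -
  from symmetric_char_poly_splits[OF assms] obtain es
    where es: "char_poly A = (\<Prod>e\<leftarrow>es. [:- e, 1:])" and len: "length es = n" by auto
  have "proots (\<Prod>e\<leftarrow>es. [:- e, 1:]) = mset es"
  proof (induction es)
    case (Cons e es)
    have "(\<Prod>e\<leftarrow>es. [:- e, 1:]) \<noteq> 0" by (auto simp: prod_list_zero_iff)
    with Cons show ?case by (simp add: proots_mult del: mult_pCons_left)
  qed simp
  hence mset: "mset (eigvals_desc A) = mset es"
    by (simp add: eigvals_desc_def es)
  from mset_eq_length[OF this] len show "length (eigvals_desc A) = n" by simp
  from mset have "prod_mset (image_mset (\<lambda>e. [:- e, 1:]) (mset (eigvals_desc A))) =
      prod_mset (image_mset (\<lambda>e. [:- e, 1:]) (mset es))" by simp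
  thus "char_poly A = (\<Prod>e\<leftarrow>eigvals_desc A. [:- e, 1:])"
    unfolding es by (simp add: prod_mset_prod_list flip: mset_map)
qed

text \<open>Throughout, \<open>Suc\<close> translates 0-based matrix indices into the 1-based
  numbering of \<open>eigval\<close>.\<close>

lemma eigval_antimono:
  assumes "A \<in> carrier_mat n n" and "A\<^sup>T = A" and "i \<le> j" and "j < n"
  shows "eigval A (Suc j) \<le> eigval A (Suc i)"
proof -
  have "sorted (rev (eigvals_desc A))" by (simp add: eigvals_desc_def)
  from sorted_rev_nth_mono[OF this assms(3)] length_eigvals_desc[OF assms(1,2)] assms(4)
  show ?thesis by (simp add: eigval_def)
qed

lemma symmetric_spectral:
  assumes "A \<in> carrier_mat n n" and "A\<^sup>T = A"
  obtains W where "W \<in> carrier_mat n n" "W\<^sup>T * W = 1\<^sub>m n" "W * W\<^sup>T = 1\<^sub>m n"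
    "W\<^sup>T * A * W = mat_diag n (\<lambda>i. eigval A (Suc i))"
proof -
  from symmetric_diagonalization[OF assms char_poly_eigvals_desc[OF assms]]
  obtain W where W: "W \<in> carrier_mat n n" and WW: "W\<^sup>T * W = 1\<^sub>m n"
    and D: "W\<^sup>T * A * W = mat_diag n ((!) (eigvals_desc A))" by auto
  have "W * W\<^sup>T = 1\<^sub>m n" using mat_mult_left_right_inverse[OF _ W WW] W by simp
  moreover have "(\<lambda>i. eigval A (Suc i)) = (!) (eigvals_desc A)" by (auto simp: eigval_def)
  ultimately show ?thesis using that[OF W WW] D by simp
qed

section \<open>Quadratic forms under congruences and isometries\<close>

lemma scalar_prod_mult_mat_vec:
  fixes B :: "'a :: comm_semiring_0 mat"
  assumes "A \<in> carrier_mat n n" and "B \<in> carrier_mat n k" and "x \<in> carrier_vec k"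
  shows "(B *\<^sub>v x) \<bullet> (A *\<^sub>v (B *\<^sub>v x)) = x \<bullet> ((B\<^sup>T * A * B) *\<^sub>v x)"
proof -
  have "x \<bullet> ((B\<^sup>T * A * B) *\<^sub>v x) = x \<bullet> (B\<^sup>T *\<^sub>v (A *\<^sub>v (B *\<^sub>v x)))"
    using assms by (simp add: assoc_mult_mat[of _ k n _ n _ k] assoc_mult_mat_vec[of _ k n _ k]
        assoc_mult_mat_vec[of _ n n _ k])
  also have "\<dots> = (B *\<^sub>v x) \<bullet> (A *\<^sub>v (B *\<^sub>v x))"
    using transpose_vec_mult_scalar[of "B\<^sup>T" k n "A *\<^sub>v (B *\<^sub>v x)" x] assms by simp
  finally show ?thesis by simp
qed

lemma symmetric_congruence:
  fixes A :: "'a :: comm_semiring_0 mat"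
  assumes "A \<in> carrier_mat n n" and "A\<^sup>T = A" and "B \<in> carrier_mat n k"
  shows "(B\<^sup>T * A * B)\<^sup>T = B\<^sup>T * A * B"
proof -
  have "(B\<^sup>T * A)\<^sup>T = A * B" using assms transpose_mult[of "B\<^sup>T" k n A n] by simp
  hence "(B\<^sup>T * A * B)\<^sup>T = B\<^sup>T * (A * B)"
    using assms transpose_mult[of "B\<^sup>T * A" k n B k] by simp
  thus ?thesis using assms by (simp add: assoc_mult_mat[of _ k n _ n _ k])
qed

lemma scalar_prod_isometry:
  fixes B :: "'a :: comm_semiring_1 mat"
  assumes "B \<in> carrier_mat n k" and "B\<^sup>T * B = 1\<^sub>m k" and "x \<in> carrier_vec k"
  shows "(B *\<^sub>v x) \<bullet> (B *\<^sub>v x) = x \<bullet> x"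
  using scalar_prod_mult_mat_vec[of "1\<^sub>m n" n B k x] assms by simp

lemma scalar_prod_mat_diag:
  fixes x :: "real vec"
  assumes "x \<in> carrier_vec n"
  shows "x \<bullet> (mat_diag n d *\<^sub>v x) = (\<Sum>i<n. d i * (x $ i)\<^sup>2)"
proof -
  have "(mat_diag n d *\<^sub>v x) $ i = d i * x $ i" if "i < n" for i
    using that assms by (simp add: mat_diag_def scalar_prod_def atLeast0LessThan
        if_distrib[of "\<lambda>a. a * _"] cong: if_cong)
  moreover have "dim_vec (mat_diag n d *\<^sub>v x) = n" by (simp add: mat_diag_def)
  ultimately show ?thesis
    unfolding scalar_prod_def by (auto simp: atLeast0LessThan power2_eq_square intro!: sum.cong)
qed

lemma scalar_prod_self:
  fixes x :: "real vec"
  assumes "x \<in> carrier_vec n"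
  shows "x \<bullet> x = (\<Sum>i<n. (x $ i)\<^sup>2)"
  using assms by (simp add: scalar_prod_def atLeast0LessThan power2_eq_square)

lemma scalar_prod_self_pos:
  fixes x :: "real vec"
  assumes "x \<in> carrier_vec n" and "x \<noteq> 0\<^sub>v n"
  shows "0 < x \<bullet> x"
  using conjugate_square_greater_0_vec[OF assms(1)] assms(2) by simp

section \<open>Interlacing and principal minors\<close>

text \<open>Serves to solve \<open>n - 1\<close> homogeneous equations in \<open>n\<close> unknowns,
  padded by a zero row to a square system. The transpose annihilates a unit vector, so the
  determinant is zero.\<close>

lemma ex_kernel_vec_of_row_zero:
  fixes F :: "'a :: idom mat"
  assumes F: "F \<in> carrier_mat n n" and i: "i < n" and zero: "row F i = 0\<^sub>v n"
  obtains c where "c \<in> carrier_vec n" "c \<noteq> 0\<^sub>v n" "F *\<^sub>v c = 0\<^sub>v n"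
proof -
  have "F\<^sup>T *\<^sub>v unit_vec n i = 0\<^sub>v n"
  proof (rule eq_vecI)
    fix j assume "j < dim_vec (0\<^sub>v n :: 'a vec)"
    hence j: "j < n" by simp
    have "(F\<^sup>T *\<^sub>v unit_vec n i) $ j = row F i $ j" using F i j by simp
    thus "(F\<^sup>T *\<^sub>v unit_vec n i) $ j = 0\<^sub>v n $ j" unfolding zero .
  qed (use F in simp)
  moreover have "unit_vec n i \<noteq> (0\<^sub>v n :: 'a vec)" using i by (simp add: unit_vec_nonzero)
  ultimately have "det F\<^sup>T = 0"
    using det_0_iff_vec_prod_zero[of "F\<^sup>T" n] F by (meson transpose_carrier_mat unit_vec_carrier)
  hence "det F = 0" using det_transpose[OF F] by simp
  thus ?thesis using det_0_iff_vec_prod_zero[OF F] that by blast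
qed

text \<open>The vector \<open>c\<close> in the proof lies in the span of the top \<open>i + 1\<close> eigenvectors of the
  compression and its image is orthogonal to the top \<open>i\<close> eigenvectors of \<open>A\<close>.\<close>

theorem poincare_separation:
  fixes A B :: "real mat"
  assumes A: "A \<in> carrier_mat n n" and sym: "A\<^sup>T = A"
    and B: "B \<in> carrier_mat n k" and BB: "B\<^sup>T * B = 1\<^sub>m k" and i: "i < k"
  shows "eigval (B\<^sup>T * A * B) (Suc i) \<le> eigval A (Suc i)"
proof -
  define K where "K = B\<^sup>T * A * B"
  have K: "K \<in> carrier_mat k k" unfolding K_def using A B by simp
  have symK: "K\<^sup>T = K" unfolding K_def by (rule symmetric_congruence[OF A sym B])
  from symmetric_spectral[OF A sym] obtain W where W: "W \<in> carrier_mat n n"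
    and WW: "W\<^sup>T * W = 1\<^sub>m n" and WW': "W * W\<^sup>T = 1\<^sub>m n"
    and WD: "W\<^sup>T * A * W = mat_diag n (\<lambda>i. eigval A (Suc i))" .
  from symmetric_spectral[OF K symK] obtain U where U: "U \<in> carrier_mat k k"
    and UU: "U\<^sup>T * U = 1\<^sub>m k" and UD: "U\<^sup>T * K * U = mat_diag k (\<lambda>i. eigval K (Suc i))" .
  \<comment> \<open>Row \<open>a\<close> of \<open>G\<close> holds the coordinates of the embedded
    eigenvectors of \<open>K\<close> along eigenvector \<open>a\<close> of \<open>A\<close>.\<close>
  define G where "G = W\<^sup>T * (B * U)"
  have G: "G \<in> carrier_mat n k" unfolding G_def using W B U by simp
  \<comment> \<open>Vanishing of the first \<open>i\<close> coordinates imposes at most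
    \<open>i\<close> equations on \<open>i + 1\<close> unknowns; the zero row makes the system
    square.\<close>
  define F where "F = mat (Suc i) (Suc i) (\<lambda>(a, b). if a < i \<and> a < n then G $$ (a, b) else 0)"
  have F: "F \<in> carrier_mat (Suc i) (Suc i)" by (simp add: F_def)
  have "row F i = 0\<^sub>v (Suc i)" by (auto simp: F_def)
  from ex_kernel_vec_of_row_zero[OF F _ this] obtain f where f: "f \<in> carrier_vec (Suc i)"
    and f0: "f \<noteq> 0\<^sub>v (Suc i)" and Ff: "F *\<^sub>v f = 0\<^sub>v (Suc i)" by auto
  define c where "c = vec k (\<lambda>j. if j \<le> i then f $ j else 0)"
  have c: "c \<in> carrier_vec k" by (simp add: c_def)
  obtain j where "j \<le> i" "f $ j \<noteq> 0" using f f0 by (metis eq_vecI carrier_vecD index_zero_vec less_Suc_eq_le)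
  hence "c $ j \<noteq> 0" "j < k" using i by (auto simp: c_def)
  hence "c \<noteq> 0\<^sub>v k" by auto
  hence cpos: "0 < c \<bullet> c" using scalar_prod_self_pos[OF c] by simp
  define x where "x = B *\<^sub>v (U *\<^sub>v c)"
  define z where "z = W\<^sup>T *\<^sub>v x"
  have x: "x \<in> carrier_vec n" and z: "z \<in> carrier_vec n"
    unfolding x_def z_def using W B U c by auto
  have xz: "x = W *\<^sub>v z" unfolding z_def using W x WW'
    by (simp flip: assoc_mult_mat_vec[of _ n n _ n])
  have zG: "z = G *\<^sub>v c" unfolding z_def x_def G_def using W B U c
    by (simp add: assoc_mult_mat_vec[of _ n n _ k] assoc_mult_mat_vec[of _ n k _ k])
  have z0: "z $ a = 0" if a: "a < i" "a < n" for a
  proof -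
    have "z $ a = (\<Sum>j\<in>{..<k}. G $$ (a, j) * c $ j)"
      unfolding zG using a G c by (simp add: scalar_prod_def atLeast0LessThan)
    also have "\<dots> = (\<Sum>j\<in>{..<Suc i}. G $$ (a, j) * c $ j)"
      using i by (intro sum.mono_neutral_right) (auto simp: c_def)
    also have "\<dots> = (F *\<^sub>v f) $ a"
      using a i f by (simp add: scalar_prod_def atLeast0LessThan F_def c_def del: sum.lessThan_Suc)
    finally show ?thesis unfolding Ff using a by simp
  qed
  have xx: "x \<bullet> x = c \<bullet> c" unfolding x_def
    using scalar_prod_isometry[OF B BB, of "U *\<^sub>v c"] scalar_prod_isometry[OF U UU c] U c by simp
  have zz: "z \<bullet> z = c \<bullet> c"
    using scalar_prod_isometry[OF W WW z] xx by (simp flip: xz)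
  \<comment> \<open>Rayleigh quotients: \<open>c\<close> is supported on indices up to
    \<open>i\<close>, so the form of \<open>K\<close> at \<open>c\<close> (in its eigenbasis) is at
    least \<open>eigval K (Suc i) * (c \<bullet> c)\<close>. Since \<open>z\<close> is supported
    from \<open>i\<close> on, the same value is at most
    \<open>eigval A (Suc i) * (c \<bullet> c)\<close>.\<close>
  have "eigval K (Suc i) * (c \<bullet> c) = (\<Sum>j<k. eigval K (Suc i) * (c $ j)\<^sup>2)"
    by (simp add: scalar_prod_self[OF c] sum_distrib_left)
  also have "\<dots> \<le> (\<Sum>j<k. eigval K (Suc j) * (c $ j)\<^sup>2)"
  proof (rule sum_mono)
    fix j assume "j \<in> {..<k}"
    thus "eigval K (Suc i) * (c $ j)\<^sup>2 \<le> eigval K (Suc j) * (c $ j)\<^sup>2"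
      using eigval_antimono[OF K symK, of j i] i
      by (cases "j \<le> i") (auto simp: c_def intro: mult_right_mono)
  qed
  also have "\<dots> = (U *\<^sub>v c) \<bullet> (K *\<^sub>v (U *\<^sub>v c))"
    using scalar_prod_mult_mat_vec[OF K U c] by (simp add: UD scalar_prod_mat_diag[OF c])
  also have "\<dots> = x \<bullet> (A *\<^sub>v x)"
    unfolding x_def K_def using scalar_prod_mult_mat_vec[OF A B] U c by simp
  also have "\<dots> = (\<Sum>j<n. eigval A (Suc j) * (z $ j)\<^sup>2)"
    unfolding xz using scalar_prod_mult_mat_vec[OF A W z] by (simp add: WD scalar_prod_mat_diag[OF z])
  also have "\<dots> \<le> (\<Sum>j<n. eigval A (Suc i) * (z $ j)\<^sup>2)"
  proof (rule sum_mono)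
    fix j assume "j \<in> {..<n}"
    thus "eigval A (Suc j) * (z $ j)\<^sup>2 \<le> eigval A (Suc i) * (z $ j)\<^sup>2"
      using eigval_antimono[OF A sym, of i j] z0[of j]
      by (cases "i \<le> j") (auto intro: mult_right_mono)
  qed
  also have "\<dots> = eigval A (Suc i) * (c \<bullet> c)"
    unfolding zz[symmetric] by (simp add: scalar_prod_self[OF z] sum_distrib_left)
  finally show ?thesis using cpos by (simp add: K_def)
qed

section \<open>Determinant, volume and definiteness in terms of eigenvalues\<close>

lemma det_symmetric_eigval:
  assumes A: "A \<in> carrier_mat n n" and sym: "A\<^sup>T = A"
  shows "det A = (\<Prod>i<n. eigval A (Suc i))"
proof -
  from symmetric_spectral[OF A sym] obtain W where W: "W \<in> carrier_mat n n"
    and WW: "W\<^sup>T * W = 1\<^sub>m n" and D: "W\<^sup>T * A * W = mat_diag n (\<lambda>i. eigval A (Suc i))" .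
  have "det (W\<^sup>T) * det W = 1" using det_mult[of "W\<^sup>T" n W] W WW by simp
  hence "det A = det (W\<^sup>T * A * W)"
    using W A by (simp add: det_mult[of _ n] ac_simps)
  also have "\<dots> = (\<Prod>i<n. eigval A (Suc i))"
    unfolding D by (subst det_upper_triangular[of _ n])
      (auto simp: mat_diag_def diag_mat_def prod.list_conv_set_nth atLeast0LessThan intro!: prod.cong)
  finally show ?thesis .
qed

text \<open>\<open>A\<^sup>T * A\<close> has determinant \<open>(det A)\<^sup>2\<close>, and its
  eigenvalues are the squared singular values. For positive definite blocks, comparing volumes thus
  means comparing determinants.\<close>

lemma vol_square:
  assumes A: "A \<in> carrier_mat p p"
  shows "vol p A = \<bar>det A\<bar>"
proof -
  have AA: "A\<^sup>T * A \<in> carrier_mat p p" and sym: "(A\<^sup>T * A)\<^sup>T = A\<^sup>T * A"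
    using A by (auto simp: transpose_mult[of _ p p _ p])
  have "(\<Prod>i<p. sqrt (eigval (A\<^sup>T * A) (Suc i))) = sqrt (\<Prod>i<p. eigval (A\<^sup>T * A) (Suc i))"
    by (induction p) (auto simp: real_sqrt_mult)
  also have "\<dots> = sqrt (det (A\<^sup>T * A))" unfolding det_symmetric_eigval[OF AA sym] ..
  also have "\<dots> = \<bar>det A\<bar>" using A by (simp add: det_mult[of _ p] det_transpose)
  finally show ?thesis
    unfolding vol_def sing_val_def
    by (simp add: prod.atLeast1_atMost_eq)
qed

lemma positive_definite_congruence:
  assumes pd: "positive_definite n M" and B: "B \<in> carrier_mat n k"
    and inj: "\<And>x. x \<in> carrier_vec k \<Longrightarrow> B *\<^sub>v x = 0\<^sub>v n \<Longrightarrow> x = 0\<^sub>v k"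
  shows "positive_definite k (B\<^sup>T * M * B)"
proof -
  have M: "M \<in> carrier_mat n n" and sym: "M\<^sup>T = M"
    and pos: "\<And>v. v \<in> carrier_vec n \<Longrightarrow> v \<noteq> 0\<^sub>v n \<Longrightarrow> 0 < v \<bullet> (M *\<^sub>v v)"
    using pd by (auto simp: positive_definite_def)
  have "(B\<^sup>T * M * B)\<^sup>T = B\<^sup>T * M * B" 
    by (rule symmetric_congruence[OF M sym B])
  moreover have "0 < x \<bullet> ((B\<^sup>T * M * B) *\<^sub>v x)" if x: "x \<in> carrier_vec k" "x \<noteq> 0\<^sub>v k" for x
    using scalar_prod_mult_mat_vec[OF M B x(1)] pos[of "B *\<^sub>v x"] inj[OF x(1)] x B by auto
  ultimately show ?thesis unfolding positive_definite_def using M B by simp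
qed

lemma positive_definite_compression:
  assumes "positive_definite n M" and B: "B \<in> carrier_mat n k" and BB: "B\<^sup>T * B = 1\<^sub>m k"
  shows "positive_definite k (B\<^sup>T * M * B)"
proof (rule positive_definite_congruence[OF assms(1) B])
  fix x :: "real vec" assume x: "x \<in> carrier_vec k" and "B *\<^sub>v x = 0\<^sub>v n"
  with scalar_prod_isometry[OF B BB x] have "x \<bullet> x = 0" by simp
  with scalar_prod_self_pos[OF x] show "x = 0\<^sub>v k" by fastforce
qed

text \<open>The eigenvalue is the value at a unit vector of the diagonalized form, which is positive
  definite as a compression by \<open>W\<close>.\<close>

lemma positive_definite_eigval_pos:
  assumes pd: "positive_definite n M" and i: "i < n"
  shows "0 < eigval M (Suc i)"
proof -
  have M: "M \<in> carrier_mat n n" and sym: "M\<^sup>T = M" using pd by (auto simp: positive_definite_def)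
  from symmetric_spectral[OF M sym] obtain W where W: "W \<in> carrier_mat n n"
    and WW: "W\<^sup>T * W = 1\<^sub>m n" and D: "W\<^sup>T * M * W = mat_diag n (\<lambda>i. eigval M (Suc i))" .
  have u: "unit_vec n i \<in> carrier_vec n" "unit_vec n i \<noteq> 0\<^sub>v n"
    using i by (auto simp: unit_vec_nonzero)
  have "0 < unit_vec n i \<bullet> ((W\<^sup>T * M * W) *\<^sub>v unit_vec n i)"
    using positive_definite_compression[OF pd W WW] u unfolding positive_definite_def by blast
  also have "\<dots> = (\<Sum>j<n. if j = i then eigval M (Suc i) else 0)"
    unfolding D scalar_prod_mat_diag[OF u(1)] by (rule sum.cong) (auto simp: unit_vec_def)
  finally show ?thesis using i by simp
qed

lemma positive_definite_det_pos:
  assumes "positive_definite n M"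
  shows "0 < det M"
  using assms positive_definite_eigval_pos[OF assms]
  by (auto simp: positive_definite_def det_symmetric_eigval[of M n] intro!: prod_pos)

text \<open>The left side is the trace of the adjugate, which is \<open>det K\<close> times the
  inverse of \<open>K\<close>; the trace of that inverse is the sum of the reciprocal
  eigenvalues.\<close>

lemma sum_principal_minors_eigval:
  fixes K :: "real mat"
  assumes K: "K \<in> carrier_mat k k" and sym: "K\<^sup>T = K"
    and nz: "\<And>i. i < k \<Longrightarrow> eigval K (Suc i) \<noteq> 0"
  shows "(\<Sum>j<k. det (mat_delete K j j)) = det K * (\<Sum>i<k. inverse (eigval K (Suc i)))"
proof -
  from symmetric_spectral[OF K sym] obtain W where W: "W \<in> carrier_mat k k"
    and WW: "W\<^sup>T * W = 1\<^sub>m k" and WW': "W * W\<^sup>T = 1\<^sub>m k"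
    and D: "W\<^sup>T * K * W = mat_diag k (\<lambda>i. eigval K (Suc i))" .
  let ?D = "mat_diag k (\<lambda>i. eigval K (Suc i))"
  let ?E = "mat_diag k (\<lambda>i. inverse (eigval K (Suc i)))"
  have DE: "?D * ?E = 1\<^sub>m k"
    by (subst mat_diag_diag) (rule eq_matI, auto simp: mat_diag_def nz)
  have KW: "K * W = W * ?D"
  proof -
    have "W * ?D = (W * W\<^sup>T) * (K * W)"
      unfolding D[symmetric] using W K by (simp add: assoc_mult_mat[of _ k k _ k _ k])
    thus ?thesis using W K WW' by simp
  qed
  have "K * (W * ?E * W\<^sup>T) = (K * W) * ?E * W\<^sup>T"
    using W K by (simp add: assoc_mult_mat[of _ k k _ k _ k] mat_diag_dim)
  also have "\<dots> = W * (?D * ?E) * W\<^sup>T"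
    unfolding KW using W K by (simp add: assoc_mult_mat[of _ k k _ k _ k] mat_diag_dim)
  also have "\<dots> = 1\<^sub>m k" using W WW' by (simp add: DE del: mat_diag_diag)
  finally have inv: "K * (W * ?E * W\<^sup>T) = 1\<^sub>m k" .
  have E: "W * ?E * W\<^sup>T \<in> carrier_mat k k"
    using W by (intro mult_carrier_mat[of _ k k]) (auto simp: mat_diag_dim)
  note adj = adj_mat[OF K]
  have "adj_mat K = adj_mat K * (K * (W * ?E * W\<^sup>T))" unfolding inv using adj by simp
  also have "\<dots> = det K \<cdot>\<^sub>m (W * ?E * W\<^sup>T)"
    using adj left_mult_one_mat[OF E] E K
    by (simp add: mult_smult_assoc_mat[of _ k k _ k] flip: assoc_mult_mat[of _ k k _ k _ k])
  finally have adjK: "adj_mat K = det K \<cdot>\<^sub>m (W * ?E * W\<^sup>T)" .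
  have entry: "det (mat_delete K j j) = det K * (\<Sum>i<k. inverse (eigval K (Suc i)) * (W $$ (j, i))\<^sup>2)"
    if j: "j < k" for j
  proof -
    have "det (mat_delete K j j) = adj_mat K $$ (j, j)"
      using K j by (simp add: adj_mat_def cofactor_def)
    also have "\<dots> = det K * (W * ?E * W\<^sup>T) $$ (j, j)" unfolding adjK
      using E j by (intro index_smult_mat) auto
    also have "(W * ?E * W\<^sup>T) $$ (j, j) = (\<Sum>i<k. inverse (eigval K (Suc i)) * (W $$ (j, i))\<^sup>2)"
      using W j by (simp add: mat_diag_mult_right[OF W] scalar_prod_def atLeast0LessThan
          power2_eq_square mult_ac)
    finally show ?thesis .
  qed
  \<comment> \<open>The columns of \<open>W\<close> have unit length, so after exchanging the sums
    each reciprocal eigenvalue is counted once.\<close>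
  have "(\<Sum>j<k. (W $$ (j, i))\<^sup>2) = 1" if i: "i < k" for i
  proof -
    have "(\<Sum>j<k. (W $$ (j, i))\<^sup>2) = (W\<^sup>T * W) $$ (i, i)"
      using W i by (simp add: scalar_prod_def atLeast0LessThan power2_eq_square)
    thus ?thesis unfolding WW using i by simp
  qed
  hence "(\<Sum>i<k. \<Sum>j<k. inverse (eigval K (Suc i)) * (W $$ (j, i))\<^sup>2) =
      (\<Sum>i<k. inverse (eigval K (Suc i)))"
    by (simp flip: sum_distrib_left)
  thus ?thesis by (subst (asm) sum.swap) (simp add: entry flip: sum_distrib_left)
qed

lemma mult_mat_unit_vec:
  fixes A :: "'a :: semiring_1 mat"
  assumes "A \<in> carrier_mat n k" and "j < k"
  shows "A *\<^sub>v unit_vec k j = col A j"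
  by (rule eq_vecI) (use assms in auto)

section \<open>Rank\<close>

lemma rank_mult_le:
  fixes A B :: "'a :: field mat"
  assumes A: "A \<in> carrier_mat n k" and B: "B \<in> carrier_mat k m"
  shows "vec_space.rank n (A * B) \<le> vec_space.rank n A"
proof -
  interpret vec_space "TYPE('a)" n .
  have AB: "A * B \<in> carrier_mat n m" using A B by simp
  have "A * B *\<^sub>v x = A *\<^sub>v (B *\<^sub>v x)" if "x \<in> carrier_vec m" for x
    using A B that by (rule assoc_mult_mat_vec)
  hence "col_space (A * B) \<subseteq> col_space A"
    unfolding col_space_eq[OF A] col_space_eq[OF AB] using A B AB by fastforce
  hence sub: "span (set (cols (A * B))) \<subseteq> span (set (cols A))" by (simp add: col_space_def)
  have sA: "subspace class_ring (span (set (cols A))) V"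
    using A cols_dim span_is_subspace by (metis carrier_matD(1))
  have sAB: "subspace class_ring (span (set (cols (A * B)))) V"
    using AB cols_dim span_is_subspace by (metis carrier_matD(1))
  show ?thesis unfolding rank_def
    using vectorspace.subspace_dim[OF subspace_is_vs[OF sA] nested_subspaces[OF sA sAB sub]]
      fin_dim_span_cols[OF A] fin_dim_span_cols[OF AB] by simp
qed

text \<open>The full rank criterion works with the set of columns, so a repeated column is excluded
  first: it would put a difference of two unit vectors into the kernel.\<close>

lemma rank_injective:
  fixes A :: "'a :: field mat"
  assumes A: "A \<in> carrier_mat n k"
    and inj: "\<And>x. x \<in> carrier_vec k \<Longrightarrow> A *\<^sub>v x = 0\<^sub>v n \<Longrightarrow> x = 0\<^sub>v k"
  shows "vec_space.rank n A = k"
proof -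
  interpret vec_space "TYPE('a)" n .
  have dist: "distinct (cols A)"
  proof (rule ccontr)
    assume "\<not> distinct (cols A)"
    then obtain i j where ij: "i < k" "j < k" "i \<noteq> j" "col A i = col A j"
      using A unfolding distinct_conv_nth by auto
    let ?x = "unit_vec k i - unit_vec k j :: 'a vec"
    have "A *\<^sub>v ?x = 0\<^sub>v n"
      using A ij by (simp add: mult_minus_distrib_mat_vec[of _ n k] mult_mat_unit_vec[of _ n k])
    from inj[OF _ this] have "?x = 0\<^sub>v k" by simp
    hence "?x $ i = 0" using ij by simp
    thus False using ij by simp
  qed
  have "lin_indpt (set (cols A))"
    using lin_depE[OF A _ dist] inj by metis
  from lin_indpt_full_rank[OF A dist this] show ?thesis .
qed

lemma positive_definite_rank:
  assumes "positive_definite p A"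
  shows "mat_rank A = p"
  using vec_space.det_rank_iff[of A p] positive_definite_det_pos[OF assms] assms
  by (auto simp: positive_definite_def)

section \<open>Principal submatrices\<close>

text \<open>Column \<open>j\<close> is the unit vector at \<open>g j\<close>. This writes principal
  submatrices as congruences, isometric when \<open>g\<close> is injective; for a permutation the
  transpose is a matrix as in \<open>is_permutation_mat\<close>.\<close>

definition selection_mat :: "nat \<Rightarrow> nat \<Rightarrow> (nat \<Rightarrow> nat) \<Rightarrow> real mat" where
  "selection_mat n k g = mat n k (\<lambda>(i, j). if i = g j then 1 else 0)"

definition principal_submat :: "real mat \<Rightarrow> nat \<Rightarrow> (nat \<Rightarrow> nat) \<Rightarrow> real mat" where
  "principal_submat M k g = mat k k (\<lambda>(i, j). M $$ (g i, g j))"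

lemma selection_mat_carrier [simp]: "selection_mat n k g \<in> carrier_mat n k"
  and dim_selection_mat [simp]: "dim_row (selection_mat n k g) = n" "dim_col (selection_mat n k g) = k"
  by (auto simp: selection_mat_def)

lemma principal_submat_carrier [simp]: "principal_submat M k g \<in> carrier_mat k k"
  and dim_principal_submat [simp]:
    "dim_row (principal_submat M k g) = k" "dim_col (principal_submat M k g) = k"
  by (auto simp: principal_submat_def)

lemma col_selection_mat: "j < k \<Longrightarrow> g j < n \<Longrightarrow> col (selection_mat n k g) j = unit_vec n (g j)"
  by (auto simp: selection_mat_def unit_vec_def)

lemma mult_selection_mat:
  assumes "M \<in> carrier_mat m n" and "\<And>j. j < k \<Longrightarrow> g j < n"
  shows "M * selection_mat n k g = mat m k (\<lambda>(i, j). M $$ (i, g j))"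
  by (rule eq_matI) (use assms in \<open>auto simp: col_selection_mat\<close>)

lemma transpose_selection_mat_mult:
  assumes "M \<in> carrier_mat n m" and "\<And>j. j < k \<Longrightarrow> g j < n"
  shows "(selection_mat n k g)\<^sup>T * M = mat k m (\<lambda>(i, j). M $$ (g i, j))"
  by (rule eq_matI) (use assms in \<open>auto simp: col_selection_mat\<close>)

lemma selection_mat_orthonormal:
  assumes "\<And>j. j < k \<Longrightarrow> g j < n" and "inj_on g {..<k}"
  shows "(selection_mat n k g)\<^sup>T * selection_mat n k g = 1\<^sub>m k"
  by (subst transpose_selection_mat_mult[of _ n k])
    (use assms in \<open>auto simp: selection_mat_def inj_on_def intro!: eq_matI\<close>)

lemma principal_submat_congruence:
  assumes "M \<in> carrier_mat n n" and "\<And>j. j < k \<Longrightarrow> g j < n"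
  shows "(selection_mat n k g)\<^sup>T * M * selection_mat n k g = principal_submat M k g"
proof -
  have "(selection_mat n k g)\<^sup>T * M * selection_mat n k g =
      mat k n (\<lambda>(i, j). M $$ (g i, j)) * selection_mat n k g"
    using assms by (simp add: transpose_selection_mat_mult)
  also have "\<dots> = principal_submat M k g"
    by (subst mult_selection_mat[of _ k n])
      (use assms(2) in \<open>auto simp: principal_submat_def intro!: eq_matI\<close>)
  finally show ?thesis .
qed

lemma principal_submat_compose:
  assumes "\<And>j. j < k \<Longrightarrow> h j < m"
  shows "principal_submat (principal_submat M m g) k h = principal_submat M k (g \<circ> h)"
  by (rule eq_matI) (use assms in \<open>auto simp: principal_submat_def\<close>)

lemma mat_delete_principal_submat:
  assumes "j \<le> p"
  shows "mat_delete (principal_submat M (Suc p) g) j j = principal_submat M p (g \<circ> insert_index j)"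
  by (rule eq_matI) (use assms in \<open>auto simp: principal_submat_def mat_delete_def insert_index_def\<close>)

lemma positive_definite_principal_submat:
  assumes "positive_definite n M" and "\<And>j. j < k \<Longrightarrow> g j < n" and "inj_on g {..<k}"
  shows "positive_definite k (principal_submat M k g)"
  using positive_definite_compression[OF assms(1) _ selection_mat_orthonormal[OF assms(2,3)]]
    principal_submat_congruence[of M n k g] assms(1,2) by (simp add: positive_definite_def)

text \<open>The form at the sum and at the difference of unit vectors \<open>i\<close> and
  \<open>j\<close> is nonnegative, so the absolute value of the entry is at most the mean of the two
  diagonal entries.\<close>

lemma positive_semidefinite_entry_le:
  fixes S :: "real mat"
  assumes S: "S \<in> carrier_mat n n" and sym: "S\<^sup>T = S"
    and psd: "\<And>x. x \<in> carrier_vec n \<Longrightarrow> 0 \<le> x \<bullet> (S *\<^sub>v x)"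
    and diag: "\<And>k. k < n \<Longrightarrow> S $$ (k, k) \<le> b"
    and ij: "i < n" "j < n"
  shows "\<bar>S $$ (i, j)\<bar> \<le> b"
proof -
  have Sji: "S $$ (j, i) = S $$ (i, j)"
    using sym S ij by (metis carrier_matD index_transpose_mat(1))
  have "0 \<le> S $$ (i, i) + 2 * s * S $$ (i, j) + s * s * S $$ (j, j)" for s
  proof -
    let ?x = "unit_vec n i + s \<cdot>\<^sub>v unit_vec n j :: real vec"
    have "S *\<^sub>v ?x = col S i + s \<cdot>\<^sub>v col S j"
      using S ij by (simp add: mult_add_distrib_mat_vec[of _ n n] mult_mat_vec[of _ n n]
          mult_mat_unit_vec[of _ n n])
    hence "?x \<bullet> (S *\<^sub>v ?x) = S $$ (i, i) + 2 * s * S $$ (i, j) + s * s * S $$ (j, j)"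
      using S ij by (simp add: add_scalar_prod_distrib[of _ n] Sji algebra_simps)
    with psd[of ?x] show ?thesis by simp
  qed
  from this[of 1] this[of "-1"] diag[OF ij(1)] diag[OF ij(2)] show ?thesis by simp
qed

section \<open>The skeleton residual\<close>

text \<open>\<open>X\<close> stands for the inverse of the leading block and is passed as an
  argument; with it, this is the approximation error in permuted coordinates.\<close>

definition skeleton_residual :: "real mat \<Rightarrow> nat \<Rightarrow> nat \<Rightarrow> real mat \<Rightarrow> real mat" where
  "skeleton_residual N n p X =
     N - N * selection_mat n p id * (X * ((selection_mat n p id)\<^sup>T * N))"

text \<open>\<open>Z\<close> is the projection along the range of \<open>E\<close> that is
  orthogonal for the form of \<open>N\<close>. From \<open>E\<^sup>T * S = 0\<close> follows
  \<open>S = Z\<^sup>T * N * Z\<close>, which gives symmetry and semidefiniteness together.\<close>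

lemma skeleton_residual:
  fixes N X :: "real mat"
  assumes pd: "positive_definite n N" and p: "p \<le> n" and X: "X \<in> carrier_mat p p"
    and AX: "principal_submat N p id * X = 1\<^sub>m p"
  defines "S \<equiv> skeleton_residual N n p X" and "E \<equiv> selection_mat n p id"
  defines "Z \<equiv> 1\<^sub>m n - E * (X * (E\<^sup>T * N))"
  shows "S \<in> carrier_mat n n" and "S\<^sup>T = S" and "S = N * Z"
    and "\<And>i j. i < p \<Longrightarrow> j < n \<Longrightarrow> S $$ (i, j) = 0"
    and "\<And>x. x \<in> carrier_vec n \<Longrightarrow> 0 \<le> x \<bullet> (S *\<^sub>v x)"
proof -
  have N: "N \<in> carrier_mat n n" and sym: "N\<^sup>T = N" using pd by (auto simp: positive_definite_def)
  have E: "E \<in> carrier_mat n p" by (simp add: E_def)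
  have A: "E\<^sup>T * N * E = principal_submat N p id"
    unfolding E_def by (rule principal_submat_congruence[OF N]) (use p in simp)
  have R: "X * (E\<^sup>T * N) \<in> carrier_mat p n" using X E N by simp
  have Z: "Z \<in> carrier_mat n n"
    unfolding Z_def using E R by (intro minus_carrier_mat mult_carrier_mat[of _ n p])
  have S_eq: "S = N - N * E * (X * (E\<^sup>T * N))" by (simp add: S_def skeleton_residual_def E_def)
  show S: "S \<in> carrier_mat n n" unfolding S_eq 
    using N E R by (intro minus_carrier_mat mult_carrier_mat[of _ n p] mult_carrier_mat[of _ n n])
  show NZ: "S = N * Z"
    unfolding S_eq Z_def using N E R
    by (simp add: mult_minus_distrib_mat[of _ n n _ n] assoc_mult_mat[of _ n n _ p _ n])
  have ES: "E\<^sup>T * S = 0\<^sub>m p n"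
  proof -
    have EN: "E\<^sup>T * N \<in> carrier_mat p n" using E N by simp
    have "E\<^sup>T * S = E\<^sup>T * N - E\<^sup>T * (N * E * (X * (E\<^sup>T * N)))"
      unfolding S_eq using N E R
      by (intro mult_minus_distrib_mat[of _ p n _ n]) auto
    also have "E\<^sup>T * (N * E * (X * (E\<^sup>T * N))) = (E\<^sup>T * N * E) * X * (E\<^sup>T * N)"
      using N E X EN R by (simp add: assoc_mult_mat[of _ p n _ n _ p]
          assoc_mult_mat[of _ p p _ p _ n] assoc_mult_mat[of _ p n _ p _ n])
    also have "\<dots> = E\<^sup>T * N" unfolding A AX by (rule left_mult_one_mat[OF EN])
    finally show ?thesis using EN by simp
  qed
  show S0: "S $$ (i, j) = 0" if "i < p" "j < n" for i j
  proof -
    have "S $$ (i, j) = (E\<^sup>T * S) $$ (i, j)"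
      unfolding E_def using that p S by (simp add: transpose_selection_mat_mult[of _ n n])
    thus ?thesis unfolding ES using that by simp
  qed
  have ZNZ: "Z\<^sup>T * N * Z = S"
  proof -
    have ZT: "Z\<^sup>T = 1\<^sub>m n - (X * (E\<^sup>T * N))\<^sup>T * E\<^sup>T"
      unfolding Z_def using E R by (simp add: transpose_minus[of _ n n] transpose_mult[of _ n p _ n])
    have "Z\<^sup>T * N * Z = Z\<^sup>T * S"
      using Z N by (simp add: NZ assoc_mult_mat[of _ n n _ n _ n])
    also have "\<dots> = S - (X * (E\<^sup>T * N))\<^sup>T * (E\<^sup>T * S)"
      unfolding ZT using S E R
      by (subst minus_mult_distrib_mat[of _ n n _ _ n]) (auto intro: assoc_mult_mat[of _ n p _ n _ n])
    also have "\<dots> = S" unfolding ES using S R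
      by (auto simp: right_mult_zero_mat[of _ n p] intro!: eq_matI)
    finally show ?thesis .
  qed
  show "S\<^sup>T = S" using symmetric_congruence[OF N sym Z] by (simp add: ZNZ)
  fix x :: "real vec" assume x: "x \<in> carrier_vec n"
  have "x \<bullet> (S *\<^sub>v x) = (Z *\<^sub>v x) \<bullet> (N *\<^sub>v (Z *\<^sub>v x))"
    using scalar_prod_mult_mat_vec[OF N Z x] by (simp add: ZNZ)
  also have "\<dots> \<ge> 0"
  proof (cases "Z *\<^sub>v x = 0\<^sub>v n")
    case True
    thus ?thesis using N by simp
  next
    case False
    moreover have "Z *\<^sub>v x \<in> carrier_vec n" using Z x by simp
    ultimately show ?thesis using pd by (auto simp: positive_definite_def intro: less_imp_le)
  qed
  finally show "0 \<le> x \<bullet> (S *\<^sub>v x)" .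
qed

text \<open>The Schur determinant formula, obtained from a vector \<open>z\<close> with last entry 1
  that \<open>K\<close> maps to the residual entry times the last unit vector; the adjugate of
  \<open>K\<close> then yields the quotient of determinants.\<close>

lemma skeleton_residual_diag_eq:
  fixes N X :: "real mat"
  assumes pd: "positive_definite n N" and X: "X \<in> carrier_mat p p"
    and AX: "principal_submat N p id * X = 1\<^sub>m p" and k: "p \<le> k" "k < n"
  shows "det (principal_submat N (Suc p) (\<lambda>i. if i < p then i else k)) =
    skeleton_residual N n p X $$ (k, k) * det (principal_submat N p id)"
proof -
  define S where "S = skeleton_residual N n p X"
  define E where "E = selection_mat n p id"
  define Z where "Z = 1\<^sub>m n - E * (X * (E\<^sup>T * N))"
  have pn: "p \<le> n" using k by simp
  note sr = skeleton_residual[OF pd pn X AX, folded S_def E_def, folded Z_def]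
  have N: "N \<in> carrier_mat n n" using pd by (auto simp: positive_definite_def)
  define g where "g = (\<lambda>i. if i < p then i else k)"
  have g: "\<And>i. i < Suc p \<Longrightarrow> g i < n" using k by (auto simp: g_def)
  define B where "B = selection_mat n (Suc p) g"
  define K where "K = principal_submat N (Suc p) g"
  have B: "B \<in> carrier_mat n (Suc p)" and K: "K \<in> carrier_mat (Suc p) (Suc p)"
    by (auto simp: B_def K_def)
  have BNB: "B\<^sup>T * N * B = K"
    unfolding B_def K_def by (rule principal_submat_congruence[OF N g])
  \<comment> \<open>\<open>y\<close> holds the coefficients that eliminate the first
    \<open>p\<close> entries of column \<open>k\<close> of \<open>N\<close>. With \<open>- y\<close>
    above a final 1, \<open>z\<close> is \<open>Z *\<^sub>v unit_vec n k\<close> in the coordinates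
    selected by \<open>g\<close>.\<close>
  define y where "y = X *\<^sub>v (E\<^sup>T *\<^sub>v (N *\<^sub>v unit_vec n k))"
  define z where "z = vec (Suc p) (\<lambda>i. if i < p then - y $ i else 1)"
  have E: "E \<in> carrier_mat n p" by (simp add: E_def)
  have y: "y \<in> carrier_vec p" unfolding y_def by (rule carrier_vecI) (use X in simp)
  have z: "z \<in> carrier_vec (Suc p)" by (simp add: z_def)
  have R: "X * (E\<^sup>T * N) \<in> carrier_mat p n" using X E N by simp
  have Z: "Z \<in> carrier_mat n n"
    unfolding Z_def using E R by (intro minus_carrier_mat mult_carrier_mat[of _ n p])
  have Ze: "Z *\<^sub>v unit_vec n k = B *\<^sub>v z"
  proof (rule eq_vecI)
    fix i assume "i < dim_vec (B *\<^sub>v z)"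
    hence i: "i < n" by (simp add: B_def)
    have "Z *\<^sub>v unit_vec n k = unit_vec n k - E *\<^sub>v y"
      unfolding Z_def y_def using E X N R
      by (simp add: minus_mult_distrib_mat_vec[of _ n n] assoc_mult_mat_vec[of _ n p _ n]
          assoc_mult_mat_vec[of _ p p _ n] assoc_mult_mat_vec[of _ p n _ n])
    moreover have "(E *\<^sub>v y) $ i = (if i < p then y $ i else 0)"
      using i y by (simp add: E_def selection_mat_def scalar_prod_def atLeast0LessThan
          if_distrib[of "\<lambda>a. a * _"] cong: if_cong)
    moreover have "(B *\<^sub>v z) $ i = (\<Sum>j<Suc p. (if i = g j then 1 else 0) * z $ j)"
      using i z by (simp add: B_def selection_mat_def scalar_prod_def atLeast0LessThan
          del: sum.lessThan_Suc)
    hence "(B *\<^sub>v z) $ i = (if i < p then - y $ i else if i = k then 1 else 0)"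
      using k by (simp add: g_def z_def if_distrib[of "\<lambda>a. a * _"] cong: if_cong)
    ultimately show "(Z *\<^sub>v unit_vec n k) $ i = (B *\<^sub>v z) $ i"
      using i k E y by auto
  qed (use Z B in auto)
  have "K *\<^sub>v z = B\<^sup>T *\<^sub>v (N *\<^sub>v (B *\<^sub>v z))"
    unfolding BNB[symmetric] using B N z
    by (simp add: assoc_mult_mat_vec[of _ "Suc p" n _ "Suc p"] assoc_mult_mat_vec[of _ "Suc p" n _ n])
  also have "\<dots> = B\<^sup>T *\<^sub>v col S k"
    unfolding Ze[symmetric] assoc_mult_mat_vec[OF N Z unit_vec_carrier, symmetric] sr(3)[symmetric]
      mult_mat_unit_vec[OF sr(1) k(2)] ..
  \<comment> \<open>The residual has zero rows at indices less than \<open>p\<close>, so only the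
    entry at the bordering index survives.\<close>
  also have "\<dots> = S $$ (k, k) \<cdot>\<^sub>v unit_vec (Suc p) p"
  proof (rule eq_vecI)
    fix i assume "i < dim_vec (S $$ (k, k) \<cdot>\<^sub>v unit_vec (Suc p) p)"
    hence i: "i < Suc p" by simp
    have "(B\<^sup>T *\<^sub>v col S k) $ i = S $$ (g i, k)"
      using i g[OF i] k sr(1) by (simp add: B_def col_selection_mat)
    thus "(B\<^sup>T *\<^sub>v col S k) $ i = (S $$ (k, k) \<cdot>\<^sub>v unit_vec (Suc p) p) $ i"
      using i sr(4)[of i k] k by (auto simp: g_def less_Suc_eq)
  qed (use B in auto)
  finally have Kz: "K *\<^sub>v z = S $$ (k, k) \<cdot>\<^sub>v unit_vec (Suc p) p" .
  note adj = adj_mat[OF K]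
  \<comment> \<open>Applying the adjugate and reading off entry \<open>p\<close>, where
    \<open>z\<close> is 1, leaves \<open>det K\<close> on one side and the cofactor at
    \<open>(p, p)\<close>, the leading minor, on the other.\<close>
  have "det K \<cdot>\<^sub>v z = (adj_mat K * K) *\<^sub>v z"
    unfolding adj(3) using z by (auto intro!: eq_vecI)
  also have "\<dots> = S $$ (k, k) \<cdot>\<^sub>v col (adj_mat K) p"
    using adj(1) K z by (simp add: assoc_mult_mat_vec[of _ "Suc p" "Suc p" _ "Suc p"] Kz
        mult_mat_vec[of _ "Suc p" "Suc p"] mult_mat_unit_vec[of _ "Suc p" "Suc p"])
  finally have "(det K \<cdot>\<^sub>v z) $ p = (S $$ (k, k) \<cdot>\<^sub>v col (adj_mat K) p) $ p" by simp
  hence "det K = S $$ (k, k) * adj_mat K $$ (p, p)" using z adj(1) by (simp add: z_def)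
  also have "adj_mat K $$ (p, p) = det (mat_delete K p p)"
    using K by (simp add: adj_mat_def cofactor_def)
  also have "mat_delete K p p = principal_submat N p id"
    unfolding K_def by (rule eq_matI) (auto simp: mat_delete_def principal_submat_def g_def)
  finally show ?thesis by (simp add: K_def g_def S_def)
qed

text \<open>By Schur complements, \<open>1 / S\<^sub>k\<^sub>k\<close> is the last diagonal entry of the inverse of the bordered
  matrix \<open>K\<close>. Maximality of the leading minor makes it the largest diagonal entry, so it is at
  least the mean of the \<open>1 / \<kappa>\<^sub>i\<close>, the eigenvalues of that inverse.\<close>

lemma skeleton_residual_diag_le:
  fixes N X :: "real mat"
  assumes pd: "positive_definite n N" and X: "X \<in> carrier_mat p p"
    and AX: "principal_submat N p id * X = 1\<^sub>m p" and k: "k < n" and pn: "p < n"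
    and max: "\<And>f. inj_on f {..<p} \<Longrightarrow> f ` {..<p} \<subseteq> {..<n} \<Longrightarrow>
      det (principal_submat N p f) \<le> det (principal_submat N p id)"
  shows "skeleton_residual N n p X $$ (k, k) \<le> harmonic_mean (p + 1) (eigval N)"
proof -
  have N: "N \<in> carrier_mat n n" and sym: "N\<^sup>T = N" using pd by (auto simp: positive_definite_def)
  have eigN_pos: "0 < eigval N (Suc i)" if "i < Suc p" for i
    using positive_definite_eigval_pos[OF pd, of i] that pn by simp
  have hm: "harmonic_mean (p + 1) (eigval N) = real (p + 1) / (\<Sum>i<Suc p. inverse (eigval N (Suc i)))"
    unfolding harmonic_mean_def by (simp add: sum.atLeast1_atMost_eq del: sum.lessThan_Suc sum.cl_ivl_Suc)
  have spos: "0 < (\<Sum>i<Suc p. inverse (eigval N (Suc i)))"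
    using eigN_pos by (intro sum_pos) auto
  let ?s = "skeleton_residual N n p X $$ (k, k)"
  show ?thesis
  proof (cases "k < p")
    case True
    \<comment> \<open>Rows of the residual within the leading block vanish, and the harmonic mean is
      positive.\<close>
    hence "?s = 0" using skeleton_residual(4)[OF pd _ X AX _ k] pn by simp
    thus ?thesis unfolding hm using spos by (simp del: sum.lessThan_Suc)
  next
    case False
    hence pk: "p \<le> k" by simp
    define g where "g = (\<lambda>i. if i < p then i else k)"
    have g: "\<And>i. i < Suc p \<Longrightarrow> g i < n" using k pk by (auto simp: g_def)
    have inj: "inj_on g {..<Suc p}" using pk by (auto simp: g_def inj_on_def split: if_splits)
    define A where "A = principal_submat N p id"
    define K where "K = principal_submat N (Suc p) g"
    define B where "B = selection_mat n (Suc p) g"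
    have BB: "B\<^sup>T * B = 1\<^sub>m (Suc p)" unfolding B_def by (rule selection_mat_orthonormal[OF g inj])
    have BNB: "B\<^sup>T * N * B = K" unfolding B_def K_def by (rule principal_submat_congruence[OF N g])
    have pdK: "positive_definite (Suc p) K"
      unfolding K_def by (rule positive_definite_principal_submat[OF pd g inj])
    have "positive_definite p A"
      unfolding A_def by (rule positive_definite_principal_submat[OF pd]) (use pn in auto)
    hence detA: "0 < det A" by (rule positive_definite_det_pos)
    have detK: "0 < det K" by (rule positive_definite_det_pos[OF pdK])
    have K: "K \<in> carrier_mat (Suc p) (Suc p)" and symK: "K\<^sup>T = K"
      using pdK by (auto simp: positive_definite_def)
    have eigK_pos: "0 < eigval K (Suc i)" if "i < Suc p" for i
      using positive_definite_eigval_pos[OF pdK that] .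
    have schur: "det K = ?s * det A"
      unfolding K_def A_def g_def by (rule skeleton_residual_diag_eq[OF pd X AX pk k])
    have spos': "0 < ?s" using detK detA unfolding schur by (simp add: zero_less_mult_iff)
    \<comment> \<open>Deleting row and column \<open>j\<close> of \<open>K\<close> leaves the
      principal submatrix of \<open>N\<close> along the injection
      \<open>g \<circ> insert_index j\<close>, so \<open>max\<close> applies.\<close>
    have "det (mat_delete K j j) \<le> det A" if j: "j < Suc p" for j
    proof -
      have ins: "insert_index j i < Suc p" if "i < p" for i using that by (auto simp: insert_index_def)
      have "inj_on (g \<circ> insert_index j) {..<p}"
        by (rule comp_inj_on[OF insert_index_inj_on inj_on_subset[OF inj]]) (use ins in auto)
      moreover have "(g \<circ> insert_index j) ` {..<p} \<subseteq> {..<n}" using ins g by auto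
      ultimately have "det (principal_submat N p (g \<circ> insert_index j)) \<le> det A"
        unfolding A_def by (rule max)
      thus ?thesis unfolding K_def using j by (simp add: mat_delete_principal_submat)
    qed
    hence "(\<Sum>j<Suc p. det (mat_delete K j j)) \<le> (\<Sum>j<Suc p. det A)" by (intro sum_mono) auto
    moreover have "(\<Sum>j<Suc p. det (mat_delete K j j)) =
        det K * (\<Sum>i<Suc p. inverse (eigval K (Suc i)))"
      by (rule sum_principal_minors_eigval[OF K symK]) (use eigK_pos in force)
    \<comment> \<open>Substituting \<open>det K = ?s * det A\<close> turns the bound on the minors
      into one on \<open>?s\<close>, and the positive factor \<open>det A\<close> cancels.\<close>
    ultimately have "det A * (?s * (\<Sum>i<Suc p. inverse (eigval K (Suc i)))) \<le> det A * real (p + 1)"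
      unfolding schur by (simp add: algebra_simps del: sum.lessThan_Suc)
    hence le: "?s * (\<Sum>i<Suc p. inverse (eigval K (Suc i))) \<le> real (p + 1)"
      using detA by (simp del: sum.lessThan_Suc)
    \<comment> \<open>Interlacing for the isometry \<open>B\<close> bounds each eigenvalue of
      \<open>K\<close> by the corresponding one of \<open>N\<close>; reciprocals reverse the
      inequality.\<close>
    have "(\<Sum>i<Suc p. inverse (eigval N (Suc i))) \<le> (\<Sum>i<Suc p. inverse (eigval K (Suc i)))"
    proof (rule sum_mono)
      fix i assume "i \<in> {..<Suc p}"
      hence i: "i < Suc p" by simp
      have "eigval K (Suc i) \<le> eigval N (Suc i)"
        using poincare_separation[OF N sym _ BB i] unfolding BNB by (simp add: B_def)
      thus "inverse (eigval N (Suc i)) \<le> inverse (eigval K (Suc i))"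
        using eigK_pos[OF i] by (rule le_imp_inverse_le)
    qed
    from mult_left_mono[OF this less_imp_le[OF spos']] le
    have "?s * (\<Sum>i<Suc p. inverse (eigval N (Suc i))) \<le> real (p + 1)" by linarith
    thus ?thesis unfolding hm using spos by (simp add: pos_le_divide_eq del: sum.lessThan_Suc)
  qed
qed

section \<open>Permutation matrices and the pseudo skeleton approximation\<close>

text \<open>Maximality is stated over permutations, whereas the minors come from injections of
  \<open>p\<close> indices. The complements of domain and image have equal size and can be
  matched.\<close>

lemma inj_on_extends_to_permutation:
  assumes inj: "inj_on f {..<p}" and im: "f ` {..<p} \<subseteq> {..<n}" and pn: "p \<le> (n :: nat)"
  obtains \<sigma> where "\<sigma> permutes {0..<n}" "\<And>i. i < p \<Longrightarrow> \<sigma> i = f i"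
proof -
  have "card ({..<n} - f ` {..<p}) = card {p..<n}"
    using card_Diff_subset[OF _ im] card_image[OF inj] by simp
  then obtain h where h: "bij_betw h {p..<n} ({..<n} - f ` {..<p})"
    by (metis finite_same_card_bij finite_Diff finite_lessThan finite_atLeastLessThan)
  define \<sigma> where "\<sigma> i = (if i < p then f i else if i < n then h i else i)" for i
  have "bij_betw \<sigma> {..<p} (f ` {..<p})"
    using inj by (auto simp: bij_betw_def \<sigma>_def inj_on_def)
  moreover have "bij_betw \<sigma> {p..<n} ({..<n} - f ` {..<p})"
    using h by (rule bij_betw_cong[THEN iffD1, rotated]) (auto simp: \<sigma>_def)
  ultimately have "bij_betw \<sigma> ({..<p} \<union> {p..<n}) (f ` {..<p} \<union> ({..<n} - f ` {..<p}))"
    by (rule bij_betw_combine) auto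
  moreover have "{..<p} \<union> {p..<n} = {0..<n}" "f ` {..<p} \<union> ({..<n} - f ` {..<p}) = {0..<n}"
    using pn im by auto
  ultimately have "\<sigma> permutes {0..<n}"
    by (intro bij_imp_permutes) (use pn in \<open>auto simp: \<sigma>_def\<close>)
  thus ?thesis by (rule that) (simp add: \<sigma>_def)
qed

text \<open>Uniqueness for the definite description: with \<open>A\<close> invertible, the equation
  \<open>A * Y * A = A\<close> alone forces \<open>Y = X\<close>.\<close>

lemma pinv_eqI:
  assumes A: "A \<in> carrier_mat p p" and X: "X \<in> carrier_mat p p" and AX: "A * X = 1\<^sub>m p"
  shows "pinv A = X"
proof -
  have XA: "X * A = 1\<^sub>m p" by (rule mat_mult_left_right_inverse[OF A X AX])
  show ?thesis unfolding pinv_def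
  proof (rule the_equality)
    show "is_moore_penrose A X" using A X AX XA by (simp add: is_moore_penrose_def)
    fix Y assume "is_moore_penrose A Y"
    hence Y: "Y \<in> carrier_mat p p" and AYA: "A * Y * A = A"
      using A by (auto simp: is_moore_penrose_def)
    have "Y = (X * A) * Y * (A * X)" using Y AX XA by simp
    also have "\<dots> = X * (A * Y * A) * X"
      using A X Y by (simp add: assoc_mult_mat[of _ p p _ p _ p])
    also have "\<dots> = X" unfolding AYA XA using X by simp
    finally show "Y = X" .
  qed
qed

lemma permutation_matE:
  assumes "is_permutation_mat n P"
  obtains \<pi> where "\<pi> permutes {0..<n}" "P = (selection_mat n n \<pi>)\<^sup>T"
proof -
  from assms obtain \<pi> where "\<pi> permutes {0..<n}" "P = mat n n (\<lambda>(i, j). if j = \<pi> i then 1 else 0)"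
    unfolding is_permutation_mat_def by auto
  moreover from this(2) have "P = (selection_mat n n \<pi>)\<^sup>T"
    by (auto simp: selection_mat_def intro!: eq_matI)
  ultimately show ?thesis using that by blast
qed

lemma permutation_mat_principal_pairs:
  assumes "\<pi> permutes {0..<n}"
  shows "((selection_mat n n \<pi>)\<^sup>T, (selection_mat n n \<pi>)\<^sup>T) \<in> principal_pairs n"
  unfolding principal_pairs_def is_permutation_mat_def using assms
  by (auto simp: selection_mat_def intro!: exI[of _ \<pi>] eq_matI)

lemma permutes_atLeast0LessThan_less:
  "\<pi> permutes {0..<n :: nat} \<Longrightarrow> i < n \<Longrightarrow> \<pi> i < n"
  using permutes_in_image[of \<pi> "{0..<n}" i] by auto

lemma leading_block_permuted:
  assumes M: "M \<in> carrier_mat n n" and \<pi>: "\<pi> permutes {0..<n}" and p: "p \<le> n"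
  shows "leading_block M p p ((selection_mat n n \<pi>)\<^sup>T) ((selection_mat n n \<pi>)\<^sup>T) = principal_submat M p \<pi>"
proof -
  have "(selection_mat n n \<pi>)\<^sup>T * M * selection_mat n n \<pi> = principal_submat M n \<pi>"
    by (rule principal_submat_congruence[OF M permutes_atLeast0LessThan_less[OF \<pi>]])
  thus ?thesis
    using p by (auto simp: leading_block_def permuted_blocks_def split_block_def Let_def
        principal_submat_def intro!: eq_matI)
qed

text \<open>The block column of \<open>A\<close> over \<open>C\<close> is \<open>N * E\<close> and
  the block row of \<open>A\<close> and \<open>B\<close> is \<open>E\<^sup>T * N\<close>, so the
  rest of the argument works with products only.\<close>

lemma pseudo_skeleton_permuted:
  assumes M: "M \<in> carrier_mat n n" and \<pi>: "\<pi> permutes {0..<n}" and p: "p \<le> n"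
  defines "N \<equiv> principal_submat M n \<pi>" and "Q \<equiv> selection_mat n n \<pi>" and "E \<equiv> selection_mat n p id"
  shows "pseudo_skeleton M p p (Q\<^sup>T) (Q\<^sup>T) =
    Q * (N * E) * pinv (principal_submat M p \<pi>) * (E\<^sup>T * N) * Q\<^sup>T"
proof -
  have N: "N \<in> carrier_mat n n" by (simp add: N_def)
  have PMP: "Q\<^sup>T * M * Q = N" unfolding Q_def N_def
    by (rule principal_submat_congruence[OF M permutes_atLeast0LessThan_less[OF \<pi>]])
  obtain A B C D where blocks: "split_block N p p = (A, B, C, D)" by (metis prod_cases4)
  have A: "A = principal_submat M p \<pi>"
    using blocks p by (auto simp: split_block_def Let_def N_def principal_submat_def intro!: eq_matI)
  have "A @\<^sub>r C = N * E"
    unfolding E_def using mult_selection_mat[OF N, of p id] blocks p N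
    by (auto simp: split_block_def Let_def append_rows_def four_block_mat_def intro!: eq_matI)
  moreover have "(A\<^sup>T @\<^sub>r B\<^sup>T)\<^sup>T = E\<^sup>T * N"
    unfolding E_def using transpose_selection_mat_mult[OF N, of p id] blocks p N
    by (auto simp: split_block_def Let_def append_rows_def four_block_mat_def intro!: eq_matI)
  ultimately show ?thesis
    by (simp add: pseudo_skeleton_def permuted_blocks_def PMP blocks A[symmetric])
qed

theorem theorem3:
  fixes M Mhat :: "real mat" and n p :: nat
  assumes "positive_definite n M"
    and "1 \<le> p" and "p \<le> n - 1"
    and "max_volume_pseudo_skeleton (principal_pairs n) M p p Mhat"
  shows "let r = mat_rank Mhat in
           r = p \<and> cheb_norm (M - Mhat) \<le> zeta r M * eigval M (r + 1)"
proof -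

  \<comment> \<open>Passage to the permuted matrix\<close>
  note pd = assms(1)
  have pn: "p < n" and pn': "p \<le> n" using assms(2,3) by auto
  have M: "M \<in> carrier_mat n n" using pd by (simp add: positive_definite_def)
  from assms(4) obtain P where "is_permutation_mat n P"
    and choice: "max_volume_choice (principal_pairs n) M p p P P"
    and MhatP: "Mhat = pseudo_skeleton M p p P P"
    unfolding max_volume_pseudo_skeleton_def max_volume_choice_def principal_pairs_def by auto
  then obtain \<pi> where \<pi>: "\<pi> permutes {0..<n}" and P: "P = (selection_mat n n \<pi>)\<^sup>T"
    by (elim permutation_matE)
  note \<pi>_less = permutes_atLeast0LessThan_less[OF \<pi>]
  have \<pi>_inj: "inj \<pi>" using \<pi> by (rule permutes_inj)
  define Q where "Q = selection_mat n n \<pi>"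
  define E where "E = selection_mat n p id"
  define N where "N = principal_submat M n \<pi>"
  define A where "A = principal_submat N p id"
  have Q: "Q \<in> carrier_mat n n" and E: "E \<in> carrier_mat n p" and N: "N \<in> carrier_mat n n"
    and A: "A \<in> carrier_mat p p" by (simp_all add: Q_def E_def N_def A_def)
  have QQ: "Q\<^sup>T * Q = 1\<^sub>m n"
    unfolding Q_def by (rule selection_mat_orthonormal[OF \<pi>_less inj_on_subset[OF \<pi>_inj]]) auto
  have QQ': "Q * Q\<^sup>T = 1\<^sub>m n" using mat_mult_left_right_inverse[OF _ Q QQ] Q by simp
  have QMQ: "Q\<^sup>T * M * Q = N"
    unfolding Q_def N_def by (rule principal_submat_congruence[OF M \<pi>_less])
  have pdN: "positive_definite n N"
    unfolding N_def by (rule positive_definite_principal_submat[OF pd \<pi>_less inj_on_subset[OF \<pi>_inj]]) auto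
  have pdA: "positive_definite p A"
    unfolding A_def by (rule positive_definite_principal_submat[OF pdN]) (use pn in auto)
  have AM: "A = principal_submat M p \<pi>"
    unfolding A_def N_def using principal_submat_compose[of p id n M \<pi>] pn by simp
  have eigval_N: "eigval N = eigval M"
  proof -
    have "similar_mat N M"
      unfolding similar_mat_def similar_mat_wit_def Let_def
      by (rule exI[of _ "Q\<^sup>T"], rule exI[of _ Q]) (use M N Q QQ QQ' QMQ in auto)
    from char_poly_similar[OF this] show ?thesis by (auto simp: eigval_def eigvals_desc_def)
  qed
  have max: "det (principal_submat N p f) \<le> det A"
    if inj: "inj_on f {..<p}" and im: "f ` {..<p} \<subseteq> {..<n}" for f
  proof -
    \<comment> \<open>\<open>f\<close> is completed to a permutation of the indices of
      \<open>N\<close>; composing with \<open>\<pi>\<close> realizes the same submatrix as a leading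
      block of permuted \<open>M\<close>.\<close>
    from inj_on_extends_to_permutation[OF inj im pn'] obtain \<sigma>
      where \<sigma>: "\<sigma> permutes {0..<n}" and \<sigma>f: "\<And>i. i < p \<Longrightarrow> \<sigma> i = f i" by auto
    define \<tau> where "\<tau> = \<pi> \<circ> \<sigma>"
    have \<tau>: "\<tau> permutes {0..<n}" unfolding \<tau>_def by (rule permutes_compose[OF \<sigma> \<pi>])
    have f_less: "\<And>i. i < p \<Longrightarrow> f i < n" using im by auto
    define A' where "A' = principal_submat N p f"
    have A'M: "A' = principal_submat M p \<tau>"
      unfolding A'_def N_def
      by (rule eq_matI) (auto simp: principal_submat_def \<tau>_def \<sigma>f f_less)
    have pdA': "positive_definite p A'"
      unfolding A'_def by (rule positive_definite_principal_submat[OF pdN f_less inj])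
    have A': "A' \<in> carrier_mat p p" by (simp add: A'_def)
    \<comment> \<open>Both blocks are positive definite and so have rank \<open>p\<close>; the
      strict alternative drops out and the volume comparison remains.\<close>
    have "mat_rank A' < mat_rank A \<or> mat_rank A' = mat_rank A \<and> vol (mat_rank A) A' \<le> vol (mat_rank A) A"
      using choice permutation_mat_principal_pairs[OF \<tau>]
      unfolding max_volume_choice_def P Let_def
      by (auto simp: leading_block_permuted[OF M \<pi> pn'] leading_block_permuted[OF M \<tau> pn']
          AM[symmetric] A'M[symmetric] split: prod.splits)
    hence "vol p A' \<le> vol p A"
      unfolding positive_definite_rank[OF pdA] positive_definite_rank[OF pdA'] by simp
    thus ?thesis
      unfolding vol_square[OF A] vol_square[OF A']
      using positive_definite_det_pos[OF pdA] positive_definite_det_pos[OF pdA'] by (simp add: A'_def)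
  qed
  obtain X where X: "X \<in> carrier_mat p p" and AX: "A * X = 1\<^sub>m p"
  proof -
    have "det A \<noteq> 0" using positive_definite_det_pos[OF pdA] by simp
    from det_non_zero_imp_unit[OF A this] show ?thesis
      using that by (auto simp: Units_def ring_mat_def)
  qed
  have XA: "X * A = 1\<^sub>m p" by (rule mat_mult_left_right_inverse[OF A X AX])
  have Mhat: "Mhat = Q * (N * E) * X * (E\<^sup>T * N) * Q\<^sup>T"
    unfolding MhatP P N_def Q_def E_def pseudo_skeleton_permuted[OF M \<pi> pn'] AM[symmetric]
      pinv_eqI[OF A X AX] ..
  have ENE: "E\<^sup>T * N * E = A"
    unfolding E_def A_def by (rule principal_submat_congruence[OF N]) (use pn in simp)

  \<comment> \<open>Rank of the approximation\<close>
  define L where "L = Q * (N * E)"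
  define R where "R = X * (E\<^sup>T * N) * Q\<^sup>T"
  have L: "L \<in> carrier_mat n p" and NE: "N * E \<in> carrier_mat n p" and EN: "E\<^sup>T * N \<in> carrier_mat p n"
    using Q N E by (auto simp: L_def)
  have XEN: "X * (E\<^sup>T * N) \<in> carrier_mat p n" using X EN by simp
  have R: "R \<in> carrier_mat p n" unfolding R_def using XEN Q by simp
  have LR: "Mhat = L * R"
    unfolding Mhat L_def[symmetric] R_def using L Q X EN XEN
    by (simp add: assoc_mult_mat[of _ n p _ p _ n] assoc_mult_mat[of _ n p _ n _ n])
  have Mhat_carrier: "Mhat \<in> carrier_mat n n" unfolding LR using L R by simp
  \<comment> \<open>\<open>Mhat = L * R\<close> and \<open>Mhat * (Q * E) = L\<close> bound the
    ranks of \<open>Mhat\<close> and \<open>L\<close> by each other. \<open>L\<close> has rank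
    \<open>p\<close> because \<open>X * E\<^sup>T * Q\<^sup>T\<close> is a left inverse.\<close>
  have rank: "mat_rank Mhat = p"
  proof -
    have "R * (Q * E) = 1\<^sub>m p"
    proof -
      have "R * (Q * E) = X * (E\<^sup>T * N) * (Q\<^sup>T * Q) * E"
        unfolding R_def using XEN Q E
        by (simp add: assoc_mult_mat[of _ p n _ n _ p] assoc_mult_mat[of _ n n _ n _ p])
      also have "\<dots> = X * (E\<^sup>T * N * E)"
        unfolding QQ using XEN X EN E
        by (simp add: right_mult_one_mat[OF XEN] assoc_mult_mat[of _ p p _ n _ p])
      finally show ?thesis unfolding ENE XA .
    qed
    hence MhatQE: "Mhat * (Q * E) = L"
      unfolding LR using L R Q E by (simp add: assoc_mult_mat[of _ n p _ n _ p])
    have "vec_space.rank n L = p"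
    proof (rule rank_injective[OF L])
      fix x :: "real vec" assume x: "x \<in> carrier_vec p" and "L *\<^sub>v x = 0\<^sub>v n"
      moreover have "X * E\<^sup>T * Q\<^sup>T * L = 1\<^sub>m p"
      proof -
        have XE: "X * E\<^sup>T \<in> carrier_mat p n" using X E by simp
        have "Q\<^sup>T * L = Q\<^sup>T * Q * (N * E)"
          unfolding L_def using Q NE by (intro assoc_mult_mat[symmetric, of _ n n _ n _ p]) auto
        also have "\<dots> = N * E" unfolding QQ by (rule left_mult_one_mat[OF NE])
        finally have "Q\<^sup>T * L = N * E" .
        hence "X * E\<^sup>T * Q\<^sup>T * L = X * E\<^sup>T * (N * E)"
          using assoc_mult_mat[of "X * E\<^sup>T" p n "Q\<^sup>T" n L p] XE Q L by simp
        also have "\<dots> = X * (E\<^sup>T * N * E)"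
          using X E N NE by (simp add: assoc_mult_mat[of _ p p _ n _ p] assoc_mult_mat[of _ p n _ n _ p])
        finally show ?thesis unfolding ENE XA .
      qed
      moreover have "X * E\<^sup>T * Q\<^sup>T * L *\<^sub>v x = X * E\<^sup>T * Q\<^sup>T *\<^sub>v (L *\<^sub>v x)"
        by (rule assoc_mult_mat_vec[OF _ L x]) (use X E Q in auto)
      moreover have "X * E\<^sup>T * Q\<^sup>T *\<^sub>v 0\<^sub>v n = 0\<^sub>v p"
        by (rule eq_vecI) (use X E Q in auto)
      ultimately show "x = 0\<^sub>v p" by simp
    qed
    with rank_mult_le[OF Mhat_carrier mult_carrier_mat[OF Q E], unfolded MhatQE]
      rank_mult_le[OF L R, folded LR] Mhat_carrier
    show ?thesis by simp
  qed

  \<comment> \<open>Entrywise error bound\<close>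
  define b where "b = harmonic_mean (p + 1) (eigval M)"
  define S where "S = skeleton_residual N n p X"
  note sr = skeleton_residual[OF pdN pn' X AX[unfolded A_def], folded S_def]
  have "S $$ (k, k) \<le> b" if "k < n" for k
    unfolding S_def b_def eigval_N[symmetric]
    by (rule skeleton_residual_diag_le[OF pdN X _ that pn]) (use AX max in \<open>auto simp: A_def\<close>)
  from positive_semidefinite_entry_le[OF sr(1,2,5) this]
  have S_le: "\<bar>S $$ (i, j)\<bar> \<le> b" if "i < n" "j < n" for i j using that by blast
  \<comment> \<open>Conjugation by \<open>Q\<close> turns \<open>Mhat\<close> into
    \<open>N * E * (X * (E\<^sup>T * N))\<close>, so \<open>S\<close> is the error with rows and
    columns permuted by \<open>\<pi>\<close>; the inverse permutation carries the bound
    back.\<close>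
  have S_entry: "S $$ (i, j) = (M - Mhat) $$ (\<pi> i, \<pi> j)" if "i < n" "j < n" for i j
  proof -
    have "Q\<^sup>T * Mhat * Q = (Q\<^sup>T * Q) * (N * E * (X * (E\<^sup>T * N))) * (Q\<^sup>T * Q)"
      unfolding LR L_def R_def using Q NE XEN
      by (simp add: assoc_mult_mat[of _ n n _ n _ n] assoc_mult_mat[of _ n n _ p _ n]
          assoc_mult_mat[of _ n p _ n _ n] assoc_mult_mat[of _ p n _ n _ n])
    also have "\<dots> = N * E * (X * (E\<^sup>T * N))" unfolding QQ
      left_mult_one_mat[OF mult_carrier_mat[OF NE XEN]]
      by (rule right_mult_one_mat[OF mult_carrier_mat[OF NE XEN]])
    finally have "S = N - Q\<^sup>T * Mhat * Q" by (simp add: S_def skeleton_residual_def E_def)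
    also have "Q\<^sup>T * Mhat * Q = principal_submat Mhat n \<pi>"
      unfolding Q_def by (rule principal_submat_congruence[OF Mhat_carrier \<pi>_less])
    finally show ?thesis using that \<pi>_less M Mhat_carrier by (simp add: N_def principal_submat_def)
  qed
  have entry_le: "\<bar>(M - Mhat) $$ (i, j)\<bar> \<le> b" if "i < n" "j < n" for i j
  proof -
    have "inv_into UNIV \<pi> i < n" "inv_into UNIV \<pi> j < n"
      using permutes_atLeast0LessThan_less[OF permutes_inv[OF \<pi>]] that by auto
    from S_le[OF this] S_entry[OF this] show ?thesis by (simp add: permutes_inverses[OF \<pi>])
  qed
  have "cheb_norm (M - Mhat) \<le> b"
    unfolding cheb_norm_def
  proof (rule Max.boundedI)
    have dims: "dim_row (M - Mhat) = n" "dim_col (M - Mhat) = n" using Mhat_carrier by auto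
    have els: "elements_mat (M - Mhat) = (\<lambda>(i, j). (M - Mhat) $$ (i, j)) ` ({..<n} \<times> {..<n})"
      unfolding elements_mat_def dims by force
    show "finite (abs ` elements_mat (M - Mhat))" unfolding els by simp
    show "abs ` elements_mat (M - Mhat) \<noteq> {}" unfolding els using pn by auto
    fix a assume "a \<in> abs ` elements_mat (M - Mhat)"
    thus "a \<le> b" unfolding els using entry_le by auto
  qed
  \<comment> \<open>\<open>zeta\<close> divides the harmonic mean by
    \<open>eigval M (p + 1)\<close>, which is positive because \<open>p < n\<close>, so the product
    gives the mean back.\<close>
  moreover have "zeta p M * eigval M (p + 1) = b"
    using positive_definite_eigval_pos[OF pd pn] by (simp add: zeta_def b_def)
  ultimately show ?thesis by (simp add: rank)
qed

end
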